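(* Let $\Phi=(G,\varphi)$ be a $\mathbb{T}$-gain graph whose underlying graph $G$ has vertex cover number $\tau(G)$ and $c(G)$ odd cycles. Then $$\mathcal{E}(\Phi)\geq 2\tau(G)-2c(G).$$ Equality holds if and only if each connected component of $\Phi$ is either an isolated vertex or a balanced $\mathbb{T}$-gain graph whose underlying graph is a complete bipartite graph with a perfect matching (i.e. $K_{p,p}$ for some $p\ge 1$).
   Context: A $\mathbb{T}$-gain graph $\Phi=(G,\varphi)$ consists of a finite simple graph $G$ with vertex set $\{v_1,\dots,v_n\}$ and a map $\varphi$ assigning to each orientation $\overrightarrow{e_{p,q}}$ of each edge $v_pv_q$ of $G$ a value in $\mathbb{T}=\{z\in\mathbb{C}:|z|=1\}$, with $\varphi(\overrightarrow{e_{q,p}})=\varphi(\overrightarrow{e_{p,q}})^{-1}$. Its adjacency matrix $A(\Phi)$ is the Hermitian $n\times n$ matrix whose $(p,q)$ entry is $\varphi(\overrightarrow{e_{p,q}})$ if $v_p\sim v_q$ and $0$ otherwise. The energy is $\mathcal{E}(\Phi)=\sum_{j}|\lambda_j|$, the sum of absolute values of the eigenvalues of $A(\Phi)$. The gain of an oriented cycle is the product of the gains of its oriented edges; $\Phi$ is balanced if every oriented cycle has gain $1$. A component of $\Phi$ is a connected component of $G$ with the restricted gains. The vertex cover number $\tau(G)$ is the minimum size of a set of vertices meeting every edge; $c(G)$ is the number of cycles of odd length in $G$. *)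

theory Defs
  imports
    "Jordan_Normal_Form.Char_Poly"
    "Graph_Theory.Graph_Theory"
begin

text \<open>
  A finite simple graph is a \<^locale>\<open>pair_graph\<close>: the edge \<open>v\<^sub>p v\<^sub>q\<close> is represented by its two
  orientations \<open>(p, q)\<close> and \<open>(q, p)\<close>. Vertices are numbered from \<open>0\<close>, as are matrix rows.
  Only the values of \<open>\<phi>\<close> on arcs matter.
\<close>

locale T_gain_graph = pair_graph G for G :: "nat pair_pre_digraph" +
  fixes n :: nat and \<phi> :: "nat \<times> nat \<Rightarrow> complex"
  assumes verts_eq: "pverts G = {..<n}"
    and gain_unit: "e \<in> parcs G \<Longrightarrow> cmod (\<phi> e) = 1"
    and gain_reverse: "(p, q) \<in> parcs G \<Longrightarrow> \<phi> (q, p) = inverse (\<phi> (p, q))"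

definition gain_adjacency_mat ::
  "nat pair_pre_digraph \<Rightarrow> nat \<Rightarrow> (nat \<times> nat \<Rightarrow> complex) \<Rightarrow> complex mat" where
  "gain_adjacency_mat G n \<phi> = mat n n (\<lambda>(p, q). if (p, q) \<in> parcs G then \<phi> (p, q) else 0)"

text \<open>
  Eigenvalues are counted with multiplicity; for a Hermitian matrix the algebraic multiplicity
  used here agrees with the geometric one.
\<close>

definition mat_energy :: "complex mat \<Rightarrow> real" where
  "mat_energy A = (\<Sum>z | eigenvalue A z. real (order z (char_poly A)) * cmod z)"

definition gain_energy ::
  "nat pair_pre_digraph \<Rightarrow> nat \<Rightarrow> (nat \<times> nat \<Rightarrow> complex) \<Rightarrow> real" where
  "gain_energy G n \<phi> = mat_energy (gain_adjacency_mat G n \<phi>)"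

definition vertex_cover :: "('a, 'b) pre_digraph \<Rightarrow> 'a set \<Rightarrow> bool" where
  "vertex_cover H C \<longleftrightarrow> C \<subseteq> verts H \<and> (\<forall>a \<in> arcs H. tail H a \<in> C \<or> head H a \<in> C)"

definition vertex_cover_number :: "('a, 'b) pre_digraph \<Rightarrow> nat" where
  "vertex_cover_number H = Min (card ` {C. vertex_cover H C})"

text \<open>
  \<^const>\<open>pre_digraph.cycle\<close> also admits the closed walk \<open>u, v, u\<close> along the two orientations of one
  edge, which is not a cycle of a simple graph; the length bound excludes it.
\<close>

definition oriented_cycle :: "('a, 'b) pre_digraph \<Rightarrow> 'b list \<Rightarrow> bool" where
  "oriented_cycle H c \<longleftrightarrow> pre_digraph.cycle H c \<and> 3 \<le> length c"

definition undirected_edges :: "('a, 'b) pre_digraph \<Rightarrow> 'b set \<Rightarrow> 'a set set" where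
  "undirected_edges H S = (\<lambda>a. {tail H a, head H a}) ` S"

text \<open>
  Cycles are counted as subgraphs: the oriented cycles that differ only in starting point and
  direction have the same set of undirected edges and are counted once.
\<close>

definition odd_cycle_number :: "('a, 'b) pre_digraph \<Rightarrow> nat" where
  "odd_cycle_number H =
     card {undirected_edges H (set c) | c. oriented_cycle H c \<and> odd (length c)}"

definition balanced :: "('a, 'b) pre_digraph \<Rightarrow> ('b \<Rightarrow> complex) \<Rightarrow> bool" where
  "balanced H \<phi> \<longleftrightarrow> (\<forall>c. oriented_cycle H c \<longrightarrow> (\<Prod>a\<leftarrow>c. \<phi> a) = 1)"

definition isolated_vertex :: "('a, 'b) pre_digraph \<Rightarrow> bool" where
  "isolated_vertex H \<longleftrightarrow> (\<exists>v. verts H = {v}) \<and> arcs H = {}"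

definition complete_bipartite :: "('a, 'b) pre_digraph \<Rightarrow> bool" where
  "complete_bipartite H \<longleftrightarrow> (\<exists>p q. K\<^bsub>p,q\<^esub> H)"

definition has_perfect_matching :: "('a, 'b) pre_digraph \<Rightarrow> bool" where
  "has_perfect_matching H \<longleftrightarrow>
     (\<exists>M \<subseteq> undirected_edges H (arcs H). \<forall>v \<in> verts H. \<exists>!e. e \<in> M \<and> v \<in> e)"

lemma complete_bipartite_perfect_matching_iff:
  assumes "verts H \<noteq> {}"
  shows "complete_bipartite H \<and> has_perfect_matching H \<longleftrightarrow> (\<exists>p\<ge>1. K\<^bsub>p,p\<^esub> H)"
proof
  assume A: "complete_bipartite H \<and> has_perfect_matching H"
  obtain p q where K: "K\<^bsub>p,q\<^esub> H"
    using conjunct1[OF A] unfolding complete_bipartite_def by (elim exE)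
  obtain M where M: "M \<subseteq> undirected_edges H (arcs H)"
    and M0: "\<forall>v \<in> verts H. \<exists>!e. e \<in> M \<and> v \<in> e"
    using conjunct2[OF A] unfolding has_perfect_matching_def by (elim exE conjE)
  note M1 = M0[rule_format]
  from K interpret graph H by (simp add: complete_bipartite_digraph_def)
  from K obtain U V where UV: "verts H = U \<union> V" "U \<inter> V = {}" "card U = p" "card V = q"
    "arcs_ends H = U \<times> V \<union> V \<times> U" unfolding complete_bipartite_digraph_def by blast
  have fin: "finite U" "finite V" using finite_verts UV(1) by (metis finite_Un)+
  have E: "\<exists>u\<in>U. \<exists>v\<in>V. e = {u, v}" if "e \<in> M" for e
  proof -
    obtain a where a: "a \<in> arcs H" "e = {tail H a, head H a}"
      using \<open>e \<in> M\<close> M by (auto simp: undirected_edges_def)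
    then have "(tail H a, head H a) \<in> arcs_ends H" by (auto simp: arcs_ends_conv)
    then have "tail H a \<in> U \<and> head H a \<in> V \<or> tail H a \<in> V \<and> head H a \<in> U"
      unfolding UV(5) by blast
    then show ?thesis using a(2) by (metis insert_commute)
  qed
  have bij: "bij_betw (\<lambda>e. THE x. x \<in> e \<inter> X) M X"
    if "X \<subseteq> verts H" "\<And>e. e \<in> M \<Longrightarrow> \<exists>!x. x \<in> e \<inter> X" for X
  proof (rule bij_betwI')
    fix e f assume ef: "e \<in> M" "f \<in> M"
    have *: "(THE x. x \<in> e \<inter> X) \<in> e \<inter> X" "(THE x. x \<in> f \<inter> X) \<in> f \<inter> X"
      using theI'[OF that(2)[OF ef(1)]] theI'[OF that(2)[OF ef(2)]] by simp_all
    have "e = f" if "x \<in> e \<inter> X" "x \<in> f \<inter> X" for x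
      using M1[of x] \<open>X \<subseteq> verts H\<close> ef that by blast
    with * show "((THE x. x \<in> e \<inter> X) = (THE x. x \<in> f \<inter> X)) = (e = f)" by metis
  next
    fix e assume "e \<in> M"
    then show "(THE x. x \<in> e \<inter> X) \<in> X" using theI'[OF that(2)] by blast
  next
    fix x assume x: "x \<in> X"
    then obtain e where e: "e \<in> M" "x \<in> e" using M1[of x] \<open>X \<subseteq> verts H\<close> by blast
    have "(THE x. x \<in> e \<inter> X) = x"
      by (rule the1_equality[OF that(2)[OF e(1)]]) (use e x in simp)
    then show "\<exists>e\<in>M. x = (THE x. x \<in> e \<inter> X)" using e(1) by (intro bexI[of _ e]) simp_all
  qed
  have bUV: "bij_betw (\<lambda>e. THE x. x \<in> e \<inter> U) M U" "bij_betw (\<lambda>e. THE x. x \<in> e \<inter> V) M V"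
  proof -
    have "\<exists>!x. x \<in> e \<inter> U" "\<exists>!x. x \<in> e \<inter> V" if e: "e \<in> M" for e
    proof -
      obtain u v where "u \<in> U" "v \<in> V" "e = {u, v}" using E[OF e] by blast
      then show "\<exists>!x. x \<in> e \<inter> U" "\<exists>!x. x \<in> e \<inter> V" using UV(2) by auto
    qed
    then show "bij_betw (\<lambda>e. THE x. x \<in> e \<inter> U) M U" "bij_betw (\<lambda>e. THE x. x \<in> e \<inter> V) M V"
      using bij[of U] bij[of V] UV(1) by simp_all
  qed
  have "card U = card V"
    using bUV[THEN bij_betw_same_card] by simp
  moreover have "card U \<noteq> 0" using calculation fin assms UV(1) by auto
  ultimately have "p = q" "p \<ge> 1" using UV(3,4) by simp_all
  with K show "\<exists>p\<ge>1. K\<^bsub>p,p\<^esub> H" by blast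
next
  assume "\<exists>p\<ge>1. K\<^bsub>p,p\<^esub> H"
  then obtain p where K: "K\<^bsub>p,p\<^esub> H" "p \<ge> 1" by blast
  then obtain U V where UV: "verts H = U \<union> V" "U \<inter> V = {}" "card U = p" "card V = p"
    "arcs_ends H = U \<times> V \<union> V \<times> U" unfolding complete_bipartite_digraph_def by blast
  have "finite U" "finite V" using UV K(2) by (auto intro: card_ge_0_finite)
  then obtain f where f: "bij_betw f U V" using UV by (metis finite_same_card_bij)
  let ?M = "(\<lambda>u. {u, f u}) ` U"
  have "?M \<subseteq> undirected_edges H (arcs H)"
  proof
    fix e assume "e \<in> ?M"
    then obtain u where u: "u \<in> U" "e = {u, f u}" by blast
    then have "(u, f u) \<in> arcs_ends H" using f UV(5) by (auto simp: bij_betw_def)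
    then show "e \<in> undirected_edges H (arcs H)"
      using u by (auto simp: arcs_ends_conv undirected_edges_def)
  qed
  moreover have M: "\<exists>!e. e \<in> ?M \<and> v \<in> e" if v: "v \<in> verts H" for v
  proof -
    have fV: "f u \<in> V" if "u \<in> U" for u using f that by (auto simp: bij_betw_def)
    have inj: "u = w" if "u \<in> U" "w \<in> U" "f u = f w" for u w
      using f that by (auto simp: bij_betw_def inj_on_def)
    consider "v \<in> U" | u where "u \<in> U" "v = f u"
      using v UV(1) f by (auto simp: bij_betw_def)
    then show ?thesis
    proof cases
      case 1
      then show ?thesis using fV UV(2) by (intro ex1I[of _ "{v, f v}"]) auto
    next
      case 2
      then show ?thesis using fV UV(2) by (intro ex1I[of _ "{u, f u}"], auto dest: inj)
    qed
  qed
  ultimately have "has_perfect_matching H" unfolding has_perfect_matching_def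
    by (intro exI[of _ ?M] conjI ballI)
  then show "complete_bipartite H \<and> has_perfect_matching H"
    using K(1) by (auto simp: complete_bipartite_def)
qed

text \<open>
  As all arcs occur in both orientations, connected components are strongly connected components.
\<close>

definition gain_components :: "nat pair_pre_digraph \<Rightarrow> (nat, nat \<times> nat) pre_digraph set" where
  "gain_components G = pre_digraph.sccs (with_proj G)"

end

theory Submission
  imports Defs "Jordan_Normal_Form.Schur_Decomposition"
begin

text \<open>
  A matching covering the vertex set \<open>D\<close>, written as an involution \<open>m\<close>, gives the partial isometry \<open>W\<close>
  that sends the unit vector of \<open>v\<close> to \<open>\<phi> (m v, v)\<close> times that of \<open>m v\<close>. Its pairing with the
  adjacency matrix \<open>A\<close> is \<open>tr (A W) = card D\<close>, and expanding \<open>A\<close> in an orthonormal eigenbasis bounds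
  this by the energy, so the energy is at least twice the matching number. Removing one vertex from
  each odd cycle leaves a bipartite graph, so by Koenig's theorem the matching number is at least
  \<open>\<tau> - c\<close>.

  In the case of equality \<open>W x = sgn l \<cdot> x\<close> for every eigenvector \<open>x\<close> with eigenvalue \<open>l \<noteq> 0\<close>, hence
  \<open>A W\<close> is the positive semidefinite matrix \<open>\<bar>A\<bar>\<close>. On \<open>D\<close> this is a Gram matrix of unit vectors whose
  entries have modulus 0 or 1, so any two of the vectors are orthogonal or proportional. In terms of
  the graph: the ends of every walk with three arcs are adjacent, and the gain of the arc joining
  them is the gain of the walk. Together with a perfect matching of the non-isolated vertices this
  describes exactly the disjoint unions of isolated vertices and balanced \<open>K\<^sub>p\<^sub>,\<^sub>p\<close>. Conversely it implies
  \<open>A\<^sup>3 x = d\<^sup>2 A x\<close> with \<open>d\<close> the degree function, which determines the energy.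
\<close>

section \<open>Spectral decomposition of Hermitian matrices\<close>

lemma mat_adjoint_carrier: "A \<in> carrier_mat m n \<Longrightarrow> mat_adjoint A \<in> carrier_mat n m"
  by (auto simp: mat_adjoint_def)

lemma dim_mat_adjoint [simp]:
  "dim_row (mat_adjoint A) = dim_col A" "dim_col (mat_adjoint A) = dim_row A"
  by (simp_all add: mat_adjoint_def)

lemma index_mat_adjoint [simp]:
  fixes A :: "complex mat"
  assumes "i < dim_col A" "j < dim_row A"
  shows "mat_adjoint A $$ (i, j) = cnj (A $$ (j, i))"
  using assms by (simp add: mat_adjoint_def mat_of_rows_def)

lemma index_mult_mat_sum:
  assumes "A \<in> carrier_mat l m" "B \<in> carrier_mat m n" "i < l" "j < n"
  shows "(A * B) $$ (i, j) = (\<Sum>k<m. A $$ (i, k) * B $$ (k, j))"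
  using assms by (simp add: scalar_prod_def lessThan_atLeast0)

lemma mat_adjoint_mult:
  fixes A B :: "complex mat"
  assumes "A \<in> carrier_mat l m" "B \<in> carrier_mat m n"
  shows "mat_adjoint (A * B) = mat_adjoint B * mat_adjoint A"
proof (rule eq_matI)
  fix i j assume ij: "i < dim_row (mat_adjoint B * mat_adjoint A)" "j < dim_col (mat_adjoint B * mat_adjoint A)"
  then have "mat_adjoint (A * B) $$ (i, j) = (\<Sum>k<m. cnj (A $$ (j, k)) * cnj (B $$ (k, i)))"
    using assms by (auto simp: scalar_prod_def lessThan_atLeast0)
  also have "\<dots> = (mat_adjoint B * mat_adjoint A) $$ (i, j)"
    using ij assms by (auto simp: scalar_prod_def lessThan_atLeast0 mult.commute)
  finally show "mat_adjoint (A * B) $$ (i, j) = (mat_adjoint B * mat_adjoint A) $$ (i, j)" .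
qed (use assms in auto)

lemma mat_adjoint_mat_adjoint [simp]: "mat_adjoint (mat_adjoint A) = (A :: complex mat)"
  by (rule eq_matI) auto

lemma unitary_extending_vec:
  fixes v :: "complex vec"
  assumes v: "v \<in> carrier_vec n" "v \<noteq> 0\<^sub>v n"
  obtains W c where "W \<in> carrier_mat n n" "mat_adjoint W * W = 1\<^sub>m n" "col W 0 = c \<cdot>\<^sub>v v"
proof -
  interpret cof_vec_space n "TYPE(complex)" .
  define b where "b = basis_completion v"
  define ws where "ws = gram_schmidt n b"
  from basis_completion[OF v, folded b_def]
  have dist_b: "distinct b" and indep: "\<not> lin_dep (set b)"
    and b: "set b \<subseteq> carrier_vec n" and hdb: "hd b = v" and len_b: "length b = n" by auto
  have n: "n \<noteq> 0" using v by (metis carrier_vecD eq_vecI index_zero_vec(2) less_nat_zero_code)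
  with hdb len_b obtain vs where bv: "b = v # vs" by (cases b) auto
  from gram_schmidt_result[OF b dist_b indep refl, folded ws_def]
  have ws: "set ws \<subseteq> carrier_vec n" "corthogonal ws" "length ws = n"
    by (auto simp: len_b)
  have hdws: "ws ! 0 = v" using gram_schmidt_hd[OF v(1), of vs, folded bv] ws(3) n
    by (metis hd_conv_nth list.size(3) ws_def)
  define r where "r i = sqrt (\<Sum>k<n. (cmod (ws ! i $ k))\<^sup>2)" for i
  define W where "W = mat n n (\<lambda>(k, i). ws ! i $ k / complex_of_real (r i))"
  have cv: "ws ! i \<in> carrier_vec n" if "i < n" for i using ws that by auto
  have sp: "ws ! i \<bullet>c ws ! j = (\<Sum>k<n. ws ! i $ k * cnj (ws ! j $ k))" if "i < n" "j < n" for i j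
    using cv[OF that(1)] cv[OF that(2)] by (simp add: scalar_prod_def lessThan_atLeast0)
  have spr: "ws ! i \<bullet>c ws ! i = complex_of_real (r i) * complex_of_real (r i)" if "i < n" for i
  proof -
    have "r i * r i = (\<Sum>k<n. (cmod (ws ! i $ k))\<^sup>2)" by (simp add: r_def sum_nonneg)
    from arg_cong[OF this, of complex_of_real] show ?thesis
      unfolding sp[OF that that] by (simp add: complex_norm_square del: of_real_power flip: of_real_power)
  qed
  have r0: "r i \<noteq> 0" if "i < n" for i
    using corthogonalD[OF ws(2), of i i] ws(3) that spr[OF that] by auto
  have W: "W \<in> carrier_mat n n" by (simp add: W_def)
  have "mat_adjoint W * W = 1\<^sub>m n"
  proof (rule eq_matI)
    fix i j assume "i < dim_row (1\<^sub>m n)" "j < dim_col (1\<^sub>m n)"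
    then have ij: "i < n" "j < n" by auto
    have "(mat_adjoint W * W) $$ (i, j) =
        (\<Sum>k<n. (ws ! j $ k * cnj (ws ! i $ k)) / (complex_of_real (r i) * complex_of_real (r j)))"
      using ij by (auto simp: W_def scalar_prod_def lessThan_atLeast0 intro!: sum.cong)
    also have "\<dots> = (ws ! j \<bullet>c ws ! i) / (complex_of_real (r i) * complex_of_real (r j))"
      unfolding sp[OF ij(2,1)] sum_divide_distrib ..
    also have "\<dots> = 1\<^sub>m n $$ (i, j)"
    proof (cases "i = j")
      case True then show ?thesis using spr r0 ij by simp
    next
      case False then show ?thesis using corthogonalD[OF ws(2), of j i] ws(3) ij by simp
    qed
    finally show "(mat_adjoint W * W) $$ (i, j) = 1\<^sub>m n $$ (i, j)" .
  qed (use W in auto)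
  moreover have "col W 0 = (1 / complex_of_real (r 0)) \<cdot>\<^sub>v v"
    using n hdws v by (intro eq_vecI) (auto simp: W_def)
  ultimately show ?thesis using that W by blast
qed

lemma complex_mat_eigenvector_exists:
  fixes A :: "complex mat"
  assumes A: "A \<in> carrier_mat n n" and n: "n \<noteq> 0"
  shows "\<exists>v e. eigenvector A v e"
proof -
  obtain as where "char_poly A = (\<Prod>a\<leftarrow>as. [:- a, 1:])" "length as = n"
    using char_poly_factorized[OF A] by blast
  then have "poly (char_poly A) (hd as) = 0" using n by (cases as) auto
  then have "eigenvalue A (hd as)" using eigenvalue_root_char_poly[OF A] by simp
  then show ?thesis unfolding eigenvalue_def by blast
qed

lemma hermitian_unitarily_diagonalizable:
  fixes A :: "complex mat"
  assumes "A \<in> carrier_mat n n" "mat_adjoint A = A"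
  shows "\<exists>U D. similar_mat_wit A D U (mat_adjoint U) \<and> diagonal_mat D"
  using assms
proof (induction n arbitrary: A)
  case 0
  have "similar_mat_wit A A A (mat_adjoint A)"
    using 0 by (intro similar_mat_witI[of _ _ 0]) (auto intro!: eq_matI)
  moreover have "diagonal_mat A" using 0 by (simp add: diagonal_mat_def)
  ultimately show ?case by blast
next
  case (Suc m)
  note A = Suc.prems(1)
  let ?n = "Suc m"
  obtain v e where ev: "eigenvector A v e" using complex_mat_eigenvector_exists[OF A] by blast
  then have v: "v \<in> carrier_vec ?n" "v \<noteq> 0\<^sub>v ?n" "A *\<^sub>v v = e \<cdot>\<^sub>v v"
    using A by (auto simp: eigenvector_def)
  obtain W c where W: "W \<in> carrier_mat ?n ?n" and WW: "mat_adjoint W * W = 1\<^sub>m ?n"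
    and c: "col W 0 = c \<cdot>\<^sub>v v" using unitary_extending_vec[OF v(1,2)] .
  have aW: "mat_adjoint W \<in> carrier_mat ?n ?n" using W by (rule mat_adjoint_carrier)
  have WW': "W * mat_adjoint W = 1\<^sub>m ?n" using mat_mult_left_right_inverse[OF aW W WW] .
  define A' where "A' = mat_adjoint W * A * W"
  have A': "A' \<in> carrier_mat ?n ?n" using A W aW by (auto simp: A'_def)
  have "similar_mat_wit A' A (mat_adjoint W) W"
    by (rule similar_mat_witI[of _ _ ?n]) (use A W aW WW WW' A' in \<open>auto simp: A'_def\<close>)
  then have sim: "similar_mat_wit A A' W (mat_adjoint W)" by (rule similar_mat_wit_sym)
  have herm: "mat_adjoint A' = A'"
  proof -
    have "mat_adjoint A' = mat_adjoint W * mat_adjoint (mat_adjoint W * A)"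
      unfolding A'_def by (rule mat_adjoint_mult) (use A W aW in auto)
    also have "mat_adjoint (mat_adjoint W * A) = A * W"
      using mat_adjoint_mult[OF aW A] Suc.prems(2) by simp
    finally show ?thesis using A W aW by (simp add: A'_def assoc_mult_mat[of _ ?n ?n _ ?n _ ?n])
  qed
  have "col A' 0 = col (mat_adjoint W * (A * W)) 0"
    unfolding A'_def by (simp only: assoc_mult_mat[OF aW A W])
  also have "\<dots> = mat_adjoint W *\<^sub>v col (A * W) 0"
    by (rule col_mult2[OF aW mult_carrier_mat[OF A W]]) simp
  also have "col (A * W) 0 = A *\<^sub>v col W 0"
    by (rule col_mult2[OF A W]) simp
  also have "A *\<^sub>v col W 0 = e \<cdot>\<^sub>v col W 0"
    unfolding c using A v by (simp add: mult_mat_vec[of _ ?n ?n] smult_smult_assoc mult.commute)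
  also have "mat_adjoint W *\<^sub>v (e \<cdot>\<^sub>v col W 0) = e \<cdot>\<^sub>v (mat_adjoint W *\<^sub>v col W 0)"
    by (rule mult_mat_vec[OF aW]) (metis W carrier_matD(1) col_dim)
  also have "mat_adjoint W *\<^sub>v col W 0 = col (mat_adjoint W * W) 0"
    by (rule col_mult2[OF aW W, symmetric]) simp
  finally have col0: "col A' 0 = e \<cdot>\<^sub>v unit_vec ?n 0" unfolding WW by simp
  have A'0: "A' $$ (i, 0) = (if i = 0 then e else 0)" if "i < ?n" for i
    using arg_cong[OF col0, of "\<lambda>x. x $ i"] that A' by (simp split: if_splits)
  have A'h: "A' $$ (i, j) = cnj (A' $$ (j, i))" if "i < ?n" "j < ?n" for i j
    using arg_cong[OF herm, of "\<lambda>X. X $$ (i, j)"] A' that by simp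
  define B where "B = mat m m (\<lambda>(i, j). A' $$ (Suc i, Suc j))"
  let ?E = "mat 1 1 (\<lambda>_. e)"
  have B: "B \<in> carrier_mat m m" by (simp add: B_def)
  have blk: "A' = four_block_mat ?E (0\<^sub>m 1 m) (0\<^sub>m m 1) B"
  proof (rule eq_matI)
    fix i j assume "i < dim_row (four_block_mat ?E (0\<^sub>m 1 m) (0\<^sub>m m 1) B)"
      "j < dim_col (four_block_mat ?E (0\<^sub>m 1 m) (0\<^sub>m m 1) B)"
    then have "i < ?n" "j < ?n" by (auto simp: B_def)
    then show "A' $$ (i, j) = four_block_mat ?E (0\<^sub>m 1 m) (0\<^sub>m m 1) B $$ (i, j)"
      using A'0[of i] A'0[of j] A'h[of i j] by (auto simp: B_def)
  qed (use A' in \<open>auto simp: B_def\<close>)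
  have "mat_adjoint B = B"
    by (intro eq_matI) (auto simp: B_def A'h[symmetric])
  from Suc.IH[OF B this] obtain U D where UD: "similar_mat_wit B D U (mat_adjoint U)" "diagonal_mat D" by blast
  have UDc: "U \<in> carrier_mat m m" "D \<in> carrier_mat m m" using similar_mat_witD2[OF B UD(1)] by auto
  let ?U = "four_block_mat (1\<^sub>m 1) (0\<^sub>m 1 m) (0\<^sub>m m 1) U"
  let ?D = "four_block_mat ?E (0\<^sub>m 1 m) (0\<^sub>m m 1) D"
  have adjU: "mat_adjoint ?U = four_block_mat (1\<^sub>m 1) (0\<^sub>m 1 m) (0\<^sub>m m 1) (mat_adjoint U)"
    using UDc by (intro eq_matI) auto
  have "similar_mat_wit A' ?D ?U (mat_adjoint ?U)"
    unfolding blk adjU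
    by (rule similar_mat_wit_four_block[OF similar_mat_wit_refl UD(1)])
       (use B UDc mat_adjoint_carrier[OF UDc(1)] in auto)
  from similar_mat_wit_trans[OF sim this]
  have "similar_mat_wit A ?D (W * ?U) (mat_adjoint (W * ?U))"
    by (subst mat_adjoint_mult[OF W]) (use UDc in auto)
  moreover have "diagonal_mat ?D"
    using UD(2) UDc unfolding diagonal_mat_def by auto
  ultimately show ?case by blast
qed

lemma order_prod_linear:
  "Polynomial.order z (\<Prod>a\<leftarrow>as. [:- a, 1:]) = count_list as (z :: complex)"
proof (induction as)
  case (Cons a as)
  have nz: "[:- a, 1:] * (\<Prod>a\<leftarrow>as. [:- a, 1:]) \<noteq> 0"
    by (auto simp: prod_list_zero_iff simp del: mult_pCons_left)
  have "Polynomial.order z [:- a, 1:] = (if a = z then 1 else 0)"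
    using order_power_n_n[of a 1] by (auto intro: order_0I)
  with order_mult[OF nz, of z] show ?case using Cons
    by (simp del: mult_pCons_left)
qed (simp add: order_0I)

lemma sum_set_count_list:
  fixes f :: "'a \<Rightarrow> real"
  shows "(\<Sum>x\<in>set xs. real (count_list xs x) * f x) = (\<Sum>x\<leftarrow>xs. f x)"
proof (induction xs)
  case (Cons a xs)
  have "(\<Sum>x\<in>set (a # xs). real (count_list (a # xs) x) * f x)
      = (\<Sum>x\<in>set (a # xs). real (count_list xs x) * f x + (if x = a then f x else 0))"
    by (intro sum.cong) (auto simp: algebra_simps)
  also have "\<dots> = (\<Sum>x\<in>set (a # xs). real (count_list xs x) * f x) + f a"
    by (simp add: sum.distrib sum.delta)
  also have "(\<Sum>x\<in>set (a # xs). real (count_list xs x) * f x) = (\<Sum>x\<in>set xs. real (count_list xs x) * f x)"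
    by (rule sum.mono_neutral_right) (auto simp: count_list_0_iff)
  finally show ?case using Cons by simp
qed simp

lemma hermitian_spectral_decomposition:
  fixes A :: "complex mat"
  assumes A: "A \<in> carrier_mat n n" and herm: "mat_adjoint A = A"
  obtains l :: "nat \<Rightarrow> real" and u :: "nat \<Rightarrow> nat \<Rightarrow> complex" where
    "\<And>i j. i < n \<Longrightarrow> j < n \<Longrightarrow> (\<Sum>k<n. u i k * cnj (u j k)) = of_bool (i = j)"
    "\<And>k j. k < n \<Longrightarrow> j < n \<Longrightarrow> (\<Sum>i<n. u i k * cnj (u i j)) = of_bool (k = j)"
    "\<And>k j. k < n \<Longrightarrow> j < n \<Longrightarrow> A $$ (k, j) = (\<Sum>i<n. l i * u i k * cnj (u i j))"
    "mat_energy A = (\<Sum>i<n. \<bar>l i\<bar>)"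
proof -
  obtain U D where sim: "similar_mat_wit A D U (mat_adjoint U)" and diag: "diagonal_mat D"
    using hermitian_unitarily_diagonalizable[OF assms] by blast
  note w = similar_mat_witD2[OF A sim]
  have herm_D: "mat_adjoint D = D"
  proof -
    have "D = mat_adjoint U * A * U"
      by (rule similar_mat_witD2(3)[OF w(5) similar_mat_wit_sym[OF sim]])
    moreover have "mat_adjoint (mat_adjoint U * A * U) = mat_adjoint U * mat_adjoint (mat_adjoint U * A)"
      by (rule mat_adjoint_mult[of _ n n _ n]) (use w(4-7) in auto)
    moreover have "mat_adjoint (mat_adjoint U * A) = A * U"
      using mat_adjoint_mult[OF w(7) A] herm by simp
    ultimately show ?thesis using w(4-7) by (metis assoc_mult_mat)
  qed
  define l where "l i = Re (D $$ (i, i))" for i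
  define u where "u i k = U $$ (k, i)" for i k
  have Dl: "D $$ (i, i) = complex_of_real (l i)" if "i < n" for i
  proof -
    have "D $$ (i, i) = cnj (D $$ (i, i))"
      using arg_cong[OF herm_D, of "\<lambda>X. X $$ (i, i)"] w(5) that by simp
    then show ?thesis by (simp add: l_def complex_eq_iff)
  qed
  have D0: "D $$ (i, j) = 0" if "i < n" "j < n" "i \<noteq> j" for i j
    using diag that w(5) by (auto simp: diagonal_mat_def)
  have 1: "(\<Sum>k<n. u i k * cnj (u j k)) = of_bool (i = j)" if "i < n" "j < n" for i j
    using arg_cong[OF w(2), of "\<lambda>X. X $$ (j, i)"] that w(4-7)
    by (auto simp: u_def scalar_prod_def lessThan_atLeast0 mult.commute)
  have 2: "(\<Sum>i<n. u i k * cnj (u i j)) = of_bool (k = j)" if "k < n" "j < n" for k j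
    using arg_cong[OF w(1), of "\<lambda>X. X $$ (k, j)"] that w(4-7)
    by (auto simp: u_def scalar_prod_def lessThan_atLeast0)
  have 3: "A $$ (k, j) = (\<Sum>i<n. l i * u i k * cnj (u i j))" if kj: "k < n" "j < n" for k j
  proof -
    have UD: "(U * D) $$ (k, i) = l i * u i k" if "i < n" for i
    proof -
      have "(U * D) $$ (k, i) = (\<Sum>t<n. U $$ (k, t) * D $$ (t, i))"
        using w(4-7) kj that by (simp add: scalar_prod_def lessThan_atLeast0)
      also have "\<dots> = (\<Sum>t<n. if t = i then U $$ (k, i) * D $$ (i, i) else 0)"
        using D0 that by (intro sum.cong) auto
      also have "\<dots> = l i * u i k" using that Dl by (simp add: u_def)
      finally show ?thesis .
    qed
    have "A $$ (k, j) = (U * D * mat_adjoint U) $$ (k, j)" using w(3) by simp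
    also have "\<dots> = (\<Sum>i<n. (U * D) $$ (k, i) * mat_adjoint U $$ (i, j))"
      by (rule index_mult_mat_sum) (use w(4-7) kj in auto)
    also have "\<dots> = (\<Sum>i<n. l i * u i k * cnj (u i j))"
      using UD w(4-7) kj by (intro sum.cong) (auto simp: u_def)
    finally show ?thesis .
  qed
  have 4: "mat_energy A = (\<Sum>i<n. \<bar>l i\<bar>)"
  proof -
    have ut: "upper_triangular D" using D0 w(5) by (auto simp: upper_triangular_def)
    have "similar_mat A D" using sim by (auto simp: similar_mat_def)
    then have cp: "char_poly A = (\<Prod>a\<leftarrow>diag_mat D. [:- a, 1:])"
      using char_poly_similar char_poly_upper_triangular[OF w(5) ut] by metis
    have "{z. eigenvalue A z} = set (diag_mat D)"
      unfolding eigenvalue_root_char_poly[OF A] cp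
      by (auto simp: poly_prod_list prod_list_zero_iff)
    then have "mat_energy A = (\<Sum>z\<in>set (diag_mat D). real (count_list (diag_mat D) z) * cmod z)"
      by (simp add: mat_energy_def cp order_prod_linear)
    also have "\<dots> = (\<Sum>z\<leftarrow>diag_mat D. cmod z)" by (rule sum_set_count_list)
    also have "\<dots> = (\<Sum>i<n. cmod (D $$ (i, i)))"
      using w(5) by (simp add: diag_mat_def o_def interv_sum_list_conv_sum_set_nat lessThan_atLeast0)
    also have "\<dots> = (\<Sum>i<n. \<bar>l i\<bar>)" using Dl by simp
    finally show ?thesis .
  qed
  show ?thesis using that 1 2 3 4 by blast
qed

section \<open>Odd cycles, vertex covers and matchings\<close>

lemma koenig:
  fixes E :: "'a set set" and col :: "'a \<Rightarrow> bool"
  assumes "finite E"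
    and "\<forall>e\<in>E. \<exists>u v. e = {u, v} \<and> col u \<noteq> col v"
    and "\<forall>C. finite C \<longrightarrow> (\<forall>e\<in>E. e \<inter> C \<noteq> {}) \<longrightarrow> k \<le> card C"
  shows "\<exists>M \<subseteq> E. pairwise disjnt M \<and> k \<le> card M"
  using assms
proof (induction "card E" arbitrary: E rule: less_induct)
  case less
  note fin = less.prems(1) and edge = less.prems(2)[rule_format] and cov = less.prems(3)[rule_format]
  show ?case
  txt \<open>
    If no edge can be dropped, \<open>E\<close> is a matching: were \<open>e\<close> and \<open>f\<close> to share \<open>x\<close>, covers \<open>S\<close> of \<open>E - {e}\<close>
    and \<open>T\<close> of \<open>E - {f}\<close> of size below \<open>k\<close> would yield a cover of \<open>E\<close> of that size, consisting of \<open>S \<inter> T\<close>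
    and the smaller colour class of the symmetric difference of \<open>S\<close> and \<open>T\<close> together with \<open>x\<close>.
  \<close>
  proof (cases "\<exists>e\<in>E. \<forall>C. finite C \<and> (\<forall>g\<in>E - {e}. g \<inter> C \<noteq> {}) \<longrightarrow> k \<le> card C")
    case True
    then obtain e where e: "e \<in> E"
      "\<forall>C. finite C \<longrightarrow> (\<forall>g\<in>E - {e}. g \<inter> C \<noteq> {}) \<longrightarrow> k \<le> card C" by blast
    have "\<exists>M \<subseteq> E - {e}. pairwise disjnt M \<and> k \<le> card M"
      by (rule less.hyps[OF card_Diff1_less[OF fin e(1)] _ _ e(2)]) (use fin less.prems(2) in auto)
    then show ?thesis by blast
  next
    case False
    then have crit: "\<exists>C. finite C \<and> (\<forall>g\<in>E - {e}. g \<inter> C \<noteq> {}) \<and> card C < k" if "e \<in> E" for e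
      using that by (meson not_le)
    have "pairwise disjnt E"
    proof (rule ccontr)
      assume "\<not> pairwise disjnt E"
      then obtain e f x where ef: "e \<in> E" "f \<in> E" "e \<noteq> f" "x \<in> e" "x \<in> f"
        by (auto simp: pairwise_def disjnt_def)
      obtain y where y: "e = {x, y}" "x \<noteq> y" using edge[OF ef(1)] ef(4) by auto
      obtain z where z: "f = {x, z}" "x \<noteq> z" using edge[OF ef(2)] ef(5) by auto
      obtain S where S: "finite S" "\<forall>g\<in>E - {e}. g \<inter> S \<noteq> {}" "card S < k" using crit[OF ef(1)] by blast
      obtain T where T: "finite T" "\<forall>g\<in>E - {f}. g \<inter> T \<noteq> {}" "card T < k" using crit[OF ef(2)] by blast
      have "e \<inter> S = {}"
      proof (rule ccontr)
        assume "e \<inter> S \<noteq> {}"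
        then have "\<forall>g\<in>E. g \<inter> S \<noteq> {}" using S(2) by (metis Diff_iff empty_iff insert_iff)
        then show False using less.prems(3) S(1,3) by (meson not_le)
      qed
      then have xy: "x \<notin> S" "y \<notin> S" using y by auto
      have "f \<inter> T = {}"
      proof (rule ccontr)
        assume "f \<inter> T \<noteq> {}"
        then have "\<forall>g\<in>E. g \<inter> T \<noteq> {}" using T(2) by (metis Diff_iff empty_iff insert_iff)
        then show False using less.prems(3) T(1,3) by (meson not_le)
      qed
      then have xz: "x \<notin> T" "z \<notin> T" using z by auto
      have yT: "y \<in> T" using bspec[OF T(2), of e] ef(1,3) xz(1) unfolding y(1) by auto
      have zS: "z \<in> S" using bspec[OF S(2), of f] ef(2,3) xy(1) unfolding z(1) by auto
      define X where "X = insert x ((S - T) \<union> (T - S))"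
      have finX: "finite X" using S T by (simp add: X_def)
      have cX: "card X = Suc (card (S - T) + card (T - S))"
        unfolding X_def using S(1) T(1) xy xz by (subst card_insert_disjoint) (auto intro!: card_Un_disjoint)
      have cS: "card S = card (S - T) + card (S \<inter> T)" "card T = card (T - S) + card (S \<inter> T)"
        using S(1) T(1) card_Diff_subset_Int[of S T] card_Diff_subset_Int[of T S]
        by (metis Int_commute add.commute card_Int_Diff)+
      have cX2: "card X = card {w\<in>X. col w = True} + card {w\<in>X. col w = False}"
      proof -
        have "X = {w\<in>X. col w = True} \<union> {w\<in>X. col w = False}" by auto
        then have "card X = card ({w\<in>X. col w = True} \<union> {w\<in>X. col w = False})" by simp
        also have "\<dots> = card {w\<in>X. col w = True} + card {w\<in>X. col w = False}"
          using finX by (intro card_Un_disjoint) auto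
        finally show ?thesis .
      qed
      have "\<exists>b. 2 * card {w\<in>X. col w = b} \<le> card X"
      proof (cases "card {w\<in>X. col w = True} \<le> card {w\<in>X. col w = False}")
        case True
        then have "2 * card {w\<in>X. col w = True} \<le> card X" using cX2 by linarith
        then show ?thesis by blast
      next
        case False
        then have "2 * card {w\<in>X. col w = False} \<le> card X" using cX2 by linarith
        then show ?thesis by blast
      qed
      then obtain b where b: "2 * card {w\<in>X. col w = b} \<le> card X" by blast
      define C where "C = {w\<in>X. col w = b} \<union> (S \<inter> T)"
      have "g \<inter> C \<noteq> {}" if g: "g \<in> E" for g
      proof (cases "g \<subseteq> X")
        case True
        then show ?thesis using edge[OF g] by (auto simp: C_def)
      next
        case False
        have "g \<noteq> e" "g \<noteq> f" using False y z yT zS xy xz by (auto simp: X_def)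
        then have "g \<inter> S \<noteq> {}" "g \<inter> T \<noteq> {}" using S(2) T(2) g by auto
        then show ?thesis using False edge[OF g] by (auto simp: C_def X_def)
      qed
      then have "k \<le> card C" using cov[of C] finX S(1) by (auto simp: C_def)
      also have "card C \<le> card {w\<in>X. col w = b} + card (S \<inter> T)" unfolding C_def by (rule card_Un_le)
      finally show False using b cX cS S(3) T(3) by linarith
    qed
    moreover have "k \<le> card E"
    proof -
      have "\<forall>e\<in>E. \<exists>x. x \<in> e" using edge by blast
      then obtain h where h: "\<forall>e\<in>E. h e \<in> e" by metis
      have "k \<le> card (h ` E)"
        using fin h by (intro cov) (simp, blast)
      also have "\<dots> \<le> card E" using fin by (rule card_image_le)
      finally show ?thesis .
    qed
    ultimately show ?thesis by blast
  qed
qed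

lemma relpow_sym:
  assumes "sym R" "(u, v) \<in> R ^^ k"
  shows "(v, u) \<in> R ^^ k"
  using assms(2)
proof (induction k arbitrary: v)
  case (Suc k)
  then obtain w where "(u, w) \<in> R ^^ k" "(w, v) \<in> R" by auto
  then show ?case using Suc.IH \<open>sym R\<close> by (meson relpow_Suc_I2 symD)
qed auto

lemma two_colouring_if_no_odd_closed_walk:
  assumes "sym R" and even: "\<forall>u k. (u, u) \<in> R ^^ k \<longrightarrow> even k"
  shows "\<exists>col :: 'a \<Rightarrow> bool. \<forall>u v. (u, v) \<in> R \<longrightarrow> col u \<noteq> col v"
proof -
  define root where "root v = (SOME r. (r, v) \<in> R\<^sup>*)" for v
  define col where "col v \<longleftrightarrow> (\<exists>k. even k \<and> (root v, v) \<in> R ^^ k)" for v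
  have "col u \<noteq> col v" if uv: "(u, v) \<in> R" for u v
  proof -
    have vu: "(v, u) \<in> R" using uv \<open>sym R\<close> by (rule symD[rotated])
    have "(r, u) \<in> R\<^sup>* \<longleftrightarrow> (r, v) \<in> R\<^sup>*" for r
      using uv vu by (meson rtrancl.rtrancl_into_rtrancl)
    then have root: "root u = root v" by (simp add: root_def)
    have "(root v, v) \<in> R\<^sup>*" unfolding root_def by (rule someI[of _ v]) simp
    then obtain q where q: "(root v, v) \<in> R ^^ q" by (metis rtrancl_imp_relpow)
    have parity: "even a \<noteq> even b" if "(root v, u) \<in> R ^^ a" "(root v, v) \<in> R ^^ b" for a b
    proof -
      have "(root v, v) \<in> R ^^ (Suc a)" using that(1) uv by auto
      moreover have "(v, root v) \<in> R ^^ b" using that(2) by (rule relpow_sym[OF \<open>sym R\<close>])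
      ultimately have "(root v, root v) \<in> R ^^ (Suc a + b)" unfolding relpow_add by (rule relcompI)
      then show ?thesis using even by fastforce
    qed
    have "(root v, u) \<in> R ^^ (Suc q)" using q vu by auto
    then show ?thesis using parity q unfolding col_def root by (metis even_Suc)
  qed
  then show ?thesis by blast
qed

lemma (in loopfree_digraph) odd_closed_awalk_imp_odd_cycle:
  assumes "awalk u p u" "odd (length p)"
  shows "\<exists>c. oriented_cycle G c \<and> odd (length c) \<and> set c \<subseteq> set p"
  using assms
proof (induction "length p" arbitrary: u p rule: less_induct)
  case less
  show ?case
  proof (cases "distinct (tl (awalk_verts u p))")
    case True
    have "p \<noteq> []" using less.prems by auto
    then have "cycle p" using True less.prems by (auto simp: cycle_def)
    moreover then have "2 \<le> length p" by (auto simp: cycle_digraph_conv)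
    then have "3 \<le> length p" using less.prems by presburger
    ultimately show ?thesis using less.prems by (auto simp: oriented_cycle_def)
  next
    case False
    obtain e es where p: "p = e # es" using less.prems by (cases p) auto
    with False less.prems have es: "awalk (head G e) es u" "\<not> distinct (awalk_verts (head G e) es)"
      by (auto simp: awalk_Cons_iff)
    obtain q r s w where qrs: "es = q @ r @ s" "0 < length r" "awalk (head G e) q w" "awalk w r w" "awalk w s u"
      using awalk_not_distinct_decomp[OF es] by blast
    show ?thesis
    proof (cases "odd (length r)")
      case True
      then show ?thesis using less.hyps[of r w] qrs p by fastforce
    next
      case False
      have "awalk u (e # q @ s) u" using less.prems qrs p awalk_appendI[OF qrs(3,5)]
        by (simp add: awalk_Cons_iff)
      then show ?thesis using less.hyps[of "e # q @ s" u] False qrs p less.prems(2) by fastforce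
    qed
  qed
qed

lemma (in pair_wf_digraph) relpow_imp_awalk:
  assumes "(u, v) \<in> R ^^ k" "R \<subseteq> parcs G" "u \<in> pverts G"
  shows "\<exists>p. awalk u p v \<and> length p = k \<and> set p \<subseteq> R"
  using assms(1)
proof (induction k arbitrary: v)
  case 0
  then show ?case using assms(3) by (auto intro: exI[of _ "[]"] simp: awalk_Nil_iff)
next
  case (Suc k)
  then obtain w where w: "(u, w) \<in> R ^^ k" "(w, v) \<in> R" by auto
  from Suc.IH[OF w(1)] obtain p where p: "awalk u p w" "length p = k" "set p \<subseteq> R" by blast
  have "awalk w [(w, v)] v" using w(2) assms(2) arc_implies_awalk[of "(w, v)"] by auto
  with p(1) have "awalk u (p @ [(w, v)]) v" by (rule awalk_appendI)
  then show ?case using p w by (intro exI[of _ "p @ [(w, v)]"]) auto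
qed

lemma (in pair_graph) odd_cycle_transversal:
  obtains S where "S \<subseteq> pverts G" "card S \<le> odd_cycle_number (with_proj G)"
    "\<And>c. oriented_cycle (with_proj G) c \<Longrightarrow> odd (length c) \<Longrightarrow> \<exists>a\<in>set c. fst a \<in> S \<or> snd a \<in> S"
proof -
  define F where "F = {undirected_edges (with_proj G) (set c) | c. oriented_cycle (with_proj G) c \<and> odd (length c)}"
  have cyc: "set c \<subseteq> parcs G" "set c \<noteq> {}" if "oriented_cycle (with_proj G) c" for c
    using that by (auto simp: oriented_cycle_def cycle_def awalk_def)
  have "F \<subseteq> Pow (undirected_edges (with_proj G) (parcs G))"
    using cyc(1) by (auto simp: F_def undirected_edges_def)
  then have finF: "finite F"
    by (rule finite_subset) (simp add: undirected_edges_def pair_finite_arcs)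
  have "\<exists>v \<in> pverts G. \<forall>c. oriented_cycle (with_proj G) c \<longrightarrow> undirected_edges (with_proj G) (set c) = X \<longrightarrow>
          (\<exists>a\<in>set c. fst a = v \<or> snd a = v)" if "X \<in> F" for X
  proof -
    from that obtain c where c: "X = undirected_edges (with_proj G) (set c)" "oriented_cycle (with_proj G) c"
      by (auto simp: F_def)
    then obtain a where a: "a \<in> set c" using cyc(2) by fastforce
    show ?thesis
    proof (rule bexI[of _ "fst a"], intro allI impI)
      show "fst a \<in> pverts G" using a cyc(1)[OF c(2)] arc_fst_in_verts by blast
    next
      fix d assume "oriented_cycle (with_proj G) d" "undirected_edges (with_proj G) (set d) = X"
      then have "{fst a, snd a} \<in> undirected_edges (with_proj G) (set d)"
        using a c by (force simp: undirected_edges_def)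
      then obtain b where "b \<in> set d" "{fst a, snd a} = {fst b, snd b}"
        by (auto simp: undirected_edges_def)
      then show "\<exists>b\<in>set d. fst b = fst a \<or> snd b = fst a"
        by (metis doubleton_eq_iff)
    qed
  qed
  then obtain h where h: "\<And>X. X \<in> F \<Longrightarrow> h X \<in> pverts G"
    "\<And>X c. X \<in> F \<Longrightarrow> oriented_cycle (with_proj G) c \<Longrightarrow> undirected_edges (with_proj G) (set c) = X \<Longrightarrow>
       \<exists>a\<in>set c. fst a = h X \<or> snd a = h X" by metis
  show ?thesis
  proof (rule that[of "h ` F"])
    show "h ` F \<subseteq> pverts G" using h(1) by blast
    show "card (h ` F) \<le> odd_cycle_number (with_proj G)"
      using card_image_le[OF finF] by (simp add: odd_cycle_number_def F_def)
    fix c assume c: "oriented_cycle (with_proj G) c" "odd (length c)"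
    then have F: "undirected_edges (with_proj G) (set c) \<in> F" by (auto simp: F_def)
    from h(2)[OF F c(1) refl] F show "\<exists>a\<in>set c. fst a \<in> h ` F \<or> snd a \<in> h ` F" by blast
  qed
qed

section \<open>Energy and matchings\<close>

definition matching_involution :: "nat pair_pre_digraph \<Rightarrow> nat set \<Rightarrow> (nat \<Rightarrow> nat) \<Rightarrow> bool" where
  "matching_involution G D m \<longleftrightarrow> (\<forall>v\<in>D. m v \<in> D \<and> m (m v) = v \<and> (v, m v) \<in> parcs G)"

definition three_walk_closed :: "nat pair_pre_digraph \<Rightarrow> (nat \<times> nat \<Rightarrow> complex) \<Rightarrow> bool" where
  "three_walk_closed G \<phi> \<longleftrightarrow> (\<forall>u v w z. (u, v) \<in> parcs G \<longrightarrow> (v, w) \<in> parcs G \<longrightarrow> (w, z) \<in> parcs G \<longrightarrow>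
     (u, z) \<in> parcs G \<and> \<phi> (u, z) = \<phi> (u, v) * \<phi> (v, w) * \<phi> (w, z))"

lemma cmod_sq_diff_smult:
  fixes y x s :: complex
  shows "(cmod (y - s * x))\<^sup>2 = (cmod y)\<^sup>2 - 2 * Re (cnj s * (y * cnj x)) + (cmod s)\<^sup>2 * (cmod x)\<^sup>2"
  unfolding cmod_power2 by (simp add: power2_eq_square algebra_simps)

context T_gain_graph
begin

lemma parcs_lt: "(u, v) \<in> parcs G \<Longrightarrow> u < n \<and> v < n"
  using in_arcsD1 in_arcsD2 verts_eq by blast

lemma parcs_sym: "(u, v) \<in> parcs G \<Longrightarrow> (v, u) \<in> parcs G"
  using graph_symmetric by blast

lemma gain_cnj: "(u, v) \<in> parcs G \<Longrightarrow> \<phi> (v, u) = cnj (\<phi> (u, v))"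
proof -
  assume uv: "(u, v) \<in> parcs G"
  have "\<phi> (u, v) * cnj (\<phi> (u, v)) = 1" using gain_unit[OF uv] by (simp flip: complex_norm_square)
  then have "inverse (\<phi> (u, v)) = cnj (\<phi> (u, v))" by (rule inverse_unique)
  then show ?thesis using gain_reverse[OF uv] by simp
qed

lemma gain_mult_cnj: "(u, v) \<in> parcs G \<Longrightarrow> \<phi> (u, v) * cnj (\<phi> (u, v)) = 1"
  using gain_unit[of "(u, v)"] by (simp flip: complex_norm_square)

abbreviation "A \<equiv> gain_adjacency_mat G n \<phi>"

lemma A_carrier: "A \<in> carrier_mat n n"
  by (simp add: gain_adjacency_mat_def)

lemma A_index: "u < n \<Longrightarrow> v < n \<Longrightarrow> A $$ (u, v) = (if (u, v) \<in> parcs G then \<phi> (u, v) else 0)"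
  by (simp add: gain_adjacency_mat_def)

lemma A_hermitian: "mat_adjoint A = A"
proof (rule eq_matI)
  fix i j assume "i < dim_row A" "j < dim_col A"
  then have ij: "i < n" "j < n" using A_carrier by auto
  then show "mat_adjoint A $$ (i, j) = A $$ (i, j)"
    using A_carrier gain_cnj[of j i] parcs_sym[of i j] parcs_sym[of j i]
    by (auto simp: A_index)
qed (use A_carrier in auto)

lemma spectral_decomposition:
  obtains l :: "nat \<Rightarrow> real" and x :: "nat \<Rightarrow> nat \<Rightarrow> complex" where
    "\<And>i. i < n \<Longrightarrow> (\<Sum>k<n. (cmod (x i k))\<^sup>2) = 1"
    "\<And>k j. k < n \<Longrightarrow> j < n \<Longrightarrow> A $$ (k, j) = (\<Sum>i<n. l i * x i k * cnj (x i j))"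
    "\<And>i k. i < n \<Longrightarrow> k < n \<Longrightarrow> (\<Sum>j<n. A $$ (k, j) * x i j) = l i * x i k"
    "gain_energy G n \<phi> = (\<Sum>i<n. \<bar>l i\<bar>)"
proof -
  obtain l :: "nat \<Rightarrow> real" and x :: "nat \<Rightarrow> nat \<Rightarrow> complex" where
    O: "\<And>i j. i < n \<Longrightarrow> j < n \<Longrightarrow> (\<Sum>k<n. x i k * cnj (x j k)) = of_bool (i = j)"
    and S: "\<And>k j. k < n \<Longrightarrow> j < n \<Longrightarrow> A $$ (k, j) = (\<Sum>i<n. l i * x i k * cnj (x i j))"
    and E: "mat_energy A = (\<Sum>i<n. \<bar>l i\<bar>)"
    by (rule hermitian_spectral_decomposition[OF A_carrier A_hermitian]) blast
  have 1: "(\<Sum>k<n. (cmod (x i k))\<^sup>2) = 1" if "i < n" for i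
  proof -
    have "complex_of_real (\<Sum>k<n. (cmod (x i k))\<^sup>2) = (\<Sum>k<n. x i k * cnj (x i k))"
      by (simp add: complex_norm_square del: of_real_power)
    also have "\<dots> = complex_of_real 1" using O[OF that that] by simp
    finally show ?thesis by (simp only: of_real_eq_iff)
  qed
  have 2: "(\<Sum>j<n. A $$ (k, j) * x i j) = l i * x i k" if ik: "i < n" "k < n" for i k
  proof -
    have "(\<Sum>j<n. A $$ (k, j) * x i j) = (\<Sum>j<n. \<Sum>t<n. l t * x t k * (x i j * cnj (x t j)))"
      using ik S by (simp add: sum_distrib_left mult_ac)
    also have "\<dots> = (\<Sum>t<n. l t * x t k * (\<Sum>j<n. x i j * cnj (x t j)))"
      by (subst sum.swap) (simp add: sum_distrib_left)
    also have "\<dots> = (\<Sum>t<n. if t = i then l t * x t k else 0)"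
      using ik O by (intro sum.cong) auto
    also have "\<dots> = l i * x i k" using ik by simp
    finally show ?thesis .
  qed
  show ?thesis using that 1 2 S E unfolding gain_energy_def by blast
qed

lemma matching_energy:
  assumes m: "matching_involution G D m"
  shows card_matching_le_energy: "real (card D) \<le> gain_energy G n \<phi>"
    and card_matching_eq_energyD: "real (card D) = gain_energy G n \<phi> \<Longrightarrow> D = Domain (parcs G) \<and> three_walk_closed G \<phi>"
proof -
  obtain l :: "nat \<Rightarrow> real" and x :: "nat \<Rightarrow> nat \<Rightarrow> complex" where
    N: "\<And>i. i < n \<Longrightarrow> (\<Sum>k<n. (cmod (x i k))\<^sup>2) = 1"
    and S: "\<And>k j. k < n \<Longrightarrow> j < n \<Longrightarrow> A $$ (k, j) = (\<Sum>i<n. l i * x i k * cnj (x i j))"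
    and E: "gain_energy G n \<phi> = (\<Sum>i<n. \<bar>l i\<bar>)"
    by (rule spectral_decomposition) blast
  have mD: "m v \<in> D" "m (m v) = v" "(v, m v) \<in> parcs G" if "v \<in> D" for v
    using m that by (auto simp: matching_involution_def)
  have Dn: "D \<subseteq> {..<n}" using mD parcs_lt by blast
  then have finD: "finite D" by (rule finite_subset) simp
  have Dlt: "v < n" "m v < n" if "v \<in> D" for v using Dn mD(1)[OF that] that by auto
  define y where "y i v = \<phi> (v, m v) * x i (m v)" for i v
  define s :: "nat \<Rightarrow> real" where "s i = (if l i \<ge> 0 then 1 else -1)" for i
  define c where "c i = (\<Sum>v\<in>D. y i v * cnj (x i v))" for i
  define q where "q i = (\<Sum>v\<in>D. (cmod (x i v))\<^sup>2)" for i
  have s: "\<bar>l i\<bar> = s i * l i" "l i = s i * \<bar>l i\<bar>" "s i * s i = 1" "(cmod (s i))\<^sup>2 = 1" for i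
    by (auto simp: s_def)
  have qle: "q i \<le> 1" if "i < n" for i
    unfolding q_def N[OF that, symmetric] using Dn by (intro sum_mono2) auto
  have qy: "(\<Sum>v\<in>D. (cmod (y i v))\<^sup>2) = q i" for i
  proof -
    have "(\<Sum>v\<in>D. (cmod (y i v))\<^sup>2) = (\<Sum>v\<in>D. (cmod (x i (m v)))\<^sup>2)"
      using gain_unit[OF mD(3)] by (intro sum.cong) (auto simp: y_def norm_mult)
    also have "\<dots> = q i" unfolding q_def
      by (rule sum.reindex_bij_witness[of D m m]) (use mD in auto)
    finally show ?thesis .
  qed
  have dev: "(\<Sum>v\<in>D. (cmod (y i v - s i * x i v))\<^sup>2) = 2 * q i - 2 * (s i * Re (c i))" for i
  proof -
    have "(\<Sum>v\<in>D. (cmod (y i v - s i * x i v))\<^sup>2)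
        = (\<Sum>v\<in>D. (cmod (y i v))\<^sup>2 - 2 * (s i * Re (y i v * cnj (x i v))) + (cmod (x i v))\<^sup>2)"
      unfolding cmod_sq_diff_smult s(4) by simp
    also have "\<dots> = q i - 2 * (s i * Re (c i)) + q i"
      unfolding c_def Re_sum sum_distrib_left sum.distrib sum_subtractf qy[of i] q_def[of i, symmetric] by simp
    finally show ?thesis by simp
  qed
  have sc: "s i * Re (c i) \<le> q i" for i
    using sum_nonneg[of D "\<lambda>v. (cmod (y i v - s i * x i v))\<^sup>2"] dev[of i] by simp
  have cardD: "real (card D) = (\<Sum>i<n. \<bar>l i\<bar> * (s i * Re (c i)))"
  proof -
    have "complex_of_real (card D) = (\<Sum>v\<in>D. \<phi> (v, m v) * A $$ (m v, v))"
    proof -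
      have "\<phi> (v, m v) * A $$ (m v, v) = 1" if "v \<in> D" for v
        using Dlt[OF that] parcs_sym[OF mD(3)[OF that]] gain_mult_cnj[OF mD(3)[OF that]] gain_cnj[OF mD(3)[OF that]]
        by (simp add: A_index)
      then show ?thesis by simp
    qed
    also have "\<dots> = (\<Sum>v\<in>D. \<Sum>i<n. l i * (y i v * cnj (x i v)))"
      using Dlt by (intro sum.cong refl) (simp add: S sum_distrib_left y_def mult_ac)
    also have "\<dots> = (\<Sum>i<n. l i * c i)"
      unfolding c_def by (subst sum.swap) (simp add: sum_distrib_left)
    finally have "Re (complex_of_real (card D)) = Re (\<Sum>i<n. l i * c i)" by (rule arg_cong)
    then have "real (card D) = (\<Sum>i<n. l i * Re (c i))" by simp
    also have "\<dots> = (\<Sum>i<n. \<bar>l i\<bar> * (s i * Re (c i)))"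
      by (intro sum.cong refl) (metis s(2) mult.assoc mult.commute)
    finally show ?thesis .
  qed
  have term_le: "\<bar>l i\<bar> * (s i * Re (c i)) \<le> \<bar>l i\<bar>" if "i < n" for i
    using order_trans[OF sc qle[OF that]] by (simp add: mult_left_le)
  show "real (card D) \<le> gain_energy G n \<phi>"
    unfolding cardD E using term_le by (intro sum_mono) auto
  assume eq: "real (card D) = gain_energy G n \<phi>"
  have "(\<Sum>i<n. \<bar>l i\<bar> - \<bar>l i\<bar> * (s i * Re (c i))) = 0"
    using eq unfolding cardD E sum_subtractf by simp
  then have "\<bar>l i\<bar> - \<bar>l i\<bar> * (s i * Re (c i)) = 0" if "i < n" for i
    using that term_le by (subst (asm) sum_nonneg_eq_0_iff) auto
  then have sc1: "s i * Re (c i) = 1" if "i < n" "l i \<noteq> 0" for i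
    using that by fastforce
  then have q1: "q i = 1" if "i < n" "l i \<noteq> 0" for i
    using sc[of i] qle[of i] that by fastforce
  have yx: "y i v = s i * x i v" if "i < n" "l i \<noteq> 0" "v \<in> D" for i v
  proof -
    have "(\<Sum>v\<in>D. (cmod (y i v - s i * x i v))\<^sup>2) = 0"
      using dev[of i] sc1[OF that(1,2)] q1[OF that(1,2)] by simp
    then show ?thesis using that(3) finD by (subst (asm) sum_nonneg_eq_0_iff) auto
  qed
  have x0: "x i k = 0" if "i < n" "l i \<noteq> 0" "k < n" "k \<notin> D" for i k
  proof -
    have "(\<Sum>k\<in>{..<n} - D. (cmod (x i k))\<^sup>2) = 0"
      using N[OF that(1)] q1[OF that(1,2)] Dn sum.subset_diff[of D "{..<n}" "\<lambda>k. (cmod (x i k))\<^sup>2"]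
      by (simp add: q_def)
    then show ?thesis using that by (subst (asm) sum_nonneg_eq_0_iff) auto
  qed
  have arcD: "u \<in> D" if "(u, v) \<in> parcs G" for u v
  proof (rule ccontr)
    assume u: "u \<notin> D"
    have uv: "u < n" "v < n" using parcs_lt[OF that] by auto
    then have "A $$ (u, v) = 0"
      unfolding S[OF uv] using x0[OF _ _ uv(1) u] by (intro sum.neutral) auto
    then show False using that uv gain_unit[OF that] by (simp add: A_index)
  qed
  then have Dom: "D = Domain (parcs G)" using mD(3) by blast
  \<comment> \<open>\<open>P\<close> is \<open>\<bar>A\<bar>\<close>, the Gram matrix of the vectors with entries \<open>sqrt \<bar>l i\<bar> * x i k\<close>\<close>
  define P where "P k j = (\<Sum>i<n. \<bar>l i\<bar> * (x i k * cnj (x i j)))" for k j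
  have AP: "A $$ (k, m j) = \<phi> (j, m j) * P k j" if "k < n" "j \<in> D" for k j
  proof -
    have "l i * x i k * cnj (x i (m j)) = \<phi> (j, m j) * (\<bar>l i\<bar> * (x i k * cnj (x i j)))" if i: "i < n" for i
    proof (cases "l i = 0")
      case False
      have "x i (m j) = \<phi> (j, m j) * cnj (\<phi> (j, m j)) * x i (m j)"
        using gain_mult_cnj[OF mD(3)[OF \<open>j \<in> D\<close>]] by simp
      also have "\<dots> = cnj (\<phi> (j, m j)) * y i j" by (simp add: y_def)
      also have "\<dots> = cnj (\<phi> (j, m j)) * (s i * x i j)" using yx[OF i False \<open>j \<in> D\<close>] by simp
      finally have "cnj (x i (m j)) = \<phi> (j, m j) * (s i * cnj (x i j))" by simp
      then show ?thesis using s(1)[of i] by simp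
    qed simp
    then show ?thesis
      unfolding P_def S[OF \<open>k < n\<close> Dlt(2)[OF \<open>j \<in> D\<close>]] sum_distrib_left by (intro sum.cong) auto
  qed
  have cP: "P j k = cnj (P k j)" for k j
    by (simp add: P_def mult.commute)
  have P1: "P k k = 1" if "k \<in> D" for k
    using AP[OF Dlt(1)[OF that] that] mD(3)[OF that] Dlt[OF that] gain_unit[OF mD(3)[OF that]]
    by (auto simp: A_index)
  have rank_one: "P k t = P k j * P j t" if kj: "k \<in> D" "j \<in> D" "cmod (P k j) = 1" for k j t
  proof -
    define a where "a = P k j"
    have "complex_of_real (\<Sum>i<n. \<bar>l i\<bar> * (cmod (x i k - a * x i j))\<^sup>2)
        = (\<Sum>i<n. \<bar>l i\<bar> * ((x i k - a * x i j) * cnj (x i k - a * x i j)))"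
      by (simp only: of_real_sum of_real_mult complex_norm_square)
    also have "\<dots> = (\<Sum>i<n. \<bar>l i\<bar> * (x i k * cnj (x i k)) - cnj a * (\<bar>l i\<bar> * (x i k * cnj (x i j)))
        - a * (\<bar>l i\<bar> * (x i j * cnj (x i k))) + a * cnj a * (\<bar>l i\<bar> * (x i j * cnj (x i j))))"
      by (intro sum.cong refl) (simp add: algebra_simps)
    also have "\<dots> = P k k - cnj a * P k j - a * P j k + a * cnj a * P j j"
      by (simp only: P_def sum.distrib sum_subtractf sum_distrib_left)
    also have "\<dots> = 0"
      using kj P1 cP[of j k] complex_norm_square[of "P k j"] by (simp add: a_def mult.commute)
    finally have "(\<Sum>i<n. \<bar>l i\<bar> * (cmod (x i k - P k j * x i j))\<^sup>2) = 0"
      by (simp only: of_real_eq_0_iff a_def)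
    then have *: "l i = 0 \<or> x i k = P k j * x i j" if "i < n" for i
      using that by (subst (asm) sum_nonneg_eq_0_iff) auto
    have "P k t = (\<Sum>i<n. P k j * (\<bar>l i\<bar> * (x i j * cnj (x i t))))"
      unfolding P_def[of k t] by (intro sum.cong refl) (use * in \<open>fastforce simp: mult_ac\<close>)
    then show ?thesis by (simp add: P_def[of j t] sum_distrib_left)
  qed
  have APm: "A $$ (k, j) = \<phi> (m j, j) * P k (m j)" if "k < n" "j \<in> D" for k j
    using AP[OF that(1) mD(1)[OF that(2)]] mD(2)[OF that(2)] by simp
  have P_arc: "cmod (P u (m v)) = 1" if "(u, v) \<in> parcs G" for u v
  proof -
    have "v \<in> D" "u < n" "v < n" using arcD parcs_sym parcs_lt that by blast+
    then have "\<phi> (u, v) = \<phi> (m v, v) * P u (m v)" using APm[of u v] that by (simp add: A_index)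
    then have "cmod (\<phi> (u, v)) = cmod (\<phi> (m v, v)) * cmod (P u (m v))" by (simp add: norm_mult)
    then show ?thesis using gain_unit[OF that] gain_unit[OF parcs_sym[OF mD(3)[OF \<open>v \<in> D\<close>]]] by simp
  qed
  have walk: "(u, z) \<in> parcs G \<and> \<phi> (u, z) = \<phi> (u, v) * \<phi> (v, w) * \<phi> (w, z)"
    if uv: "(u, v) \<in> parcs G" and vw: "(v, w) \<in> parcs G" and wz: "(w, z) \<in> parcs G" for u v w z
  proof -
    have D: "u \<in> D" "v \<in> D" "w \<in> D" "z \<in> D" using arcD parcs_sym uv vw wz by blast+
    have wv: "(w, v) \<in> parcs G" using vw by (rule parcs_sym)
    have "A $$ (u, z) * A $$ (w, v) = A $$ (u, v) * A $$ (w, z)"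
      unfolding APm[OF Dlt(1)[OF D(1)] D(4)] APm[OF Dlt(1)[OF D(3)] D(2)] APm[OF Dlt(1)[OF D(1)] D(2)]
        APm[OF Dlt(1)[OF D(3)] D(4)]
      by (subst rank_one[OF D(1) mD(1)[OF D(2)] P_arc[OF uv], of "m z"],
          subst rank_one[OF D(3) mD(1)[OF D(2)] P_arc[OF wv], of "m z"]) (simp add: mult_ac)
    then have eq: "A $$ (u, z) * \<phi> (w, v) = \<phi> (u, v) * \<phi> (w, z)"
      using uv wv wz Dlt(1) D by (simp add: A_index)
    have "A $$ (u, z) = A $$ (u, z) * (\<phi> (w, v) * \<phi> (v, w))"
      using gain_mult_cnj[OF wv] gain_cnj[OF wv] by simp
    also have "\<dots> = \<phi> (u, v) * \<phi> (v, w) * \<phi> (w, z)" using eq by (metis mult.assoc mult.commute)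
    finally have Auz: "A $$ (u, z) = \<phi> (u, v) * \<phi> (v, w) * \<phi> (w, z)" .
    moreover have "\<phi> (u, v) * \<phi> (v, w) * \<phi> (w, z) \<noteq> 0"
      using gain_unit[OF uv] gain_unit[OF vw] gain_unit[OF wz] by auto
    ultimately show ?thesis using Dlt(1) D by (auto simp: A_index split: if_splits)
  qed
  show "D = Domain (parcs G) \<and> three_walk_closed G \<phi>"
    unfolding three_walk_closed_def by (intro conjI[OF Dom] allI impI) (rule walk)
qed

lemma three_walk_closed_energy:
  assumes m: "matching_involution G (Domain (parcs G)) m" and closed: "three_walk_closed G \<phi>"
  shows "gain_energy G n \<phi> = card (Domain (parcs G))"
proof -
  obtain l :: "nat \<Rightarrow> real" and x :: "nat \<Rightarrow> nat \<Rightarrow> complex" where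
    N: "\<And>i. i < n \<Longrightarrow> (\<Sum>k<n. (cmod (x i k))\<^sup>2) = 1"
    and S: "\<And>k j. k < n \<Longrightarrow> j < n \<Longrightarrow> A $$ (k, j) = (\<Sum>i<n. l i * x i k * cnj (x i j))"
    and eig: "\<And>i k. i < n \<Longrightarrow> k < n \<Longrightarrow> (\<Sum>j<n. A $$ (k, j) * x i j) = l i * x i k"
    and E: "gain_energy G n \<phi> = (\<Sum>i<n. \<bar>l i\<bar>)"
    by (rule spectral_decomposition) blast
  define nb where "nb u = {v. (u, v) \<in> parcs G}" for u
  define d where "d u = real (card (nb u))" for u
  have nb_lt: "nb u \<subseteq> {..<n}" for u using parcs_lt by (auto simp: nb_def)
  then have fin_nb: "finite (nb u)" for u by (rule finite_subset) simp
  have walk: "(u, z) \<in> parcs G" "\<phi> (u, z) = \<phi> (u, v) * \<phi> (v, w) * \<phi> (w, z)"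
    if "(u, v) \<in> parcs G" "(v, w) \<in> parcs G" "(w, z) \<in> parcs G" for u v w z
    using closed that unfolding three_walk_closed_def by blast+
  have mm: "m (m v) = v" "(v, m v) \<in> parcs G" if "(v, w) \<in> parcs G" for v w
    using m that by (auto simp: matching_involution_def)
  have d_le: "d u \<le> d z" if uz: "(u, z) \<in> parcs G" for u z
  proof -
    have "inj_on m (nb u)"
      by (rule inj_on_inverseI[of _ m]) (use mm(1)[OF parcs_sym] in \<open>simp add: nb_def\<close>)
    moreover have "m ` nb u \<subseteq> nb z"
    proof
      fix w assume "w \<in> m ` nb u"
      then obtain v where v: "(u, v) \<in> parcs G" "w = m v" by (auto simp: nb_def)
      have "(v, w) \<in> parcs G" using mm(2)[OF parcs_sym[OF v(1)]] v(2) by simp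
      then show "w \<in> nb z" using walk(1)[OF parcs_sym[OF uz] v(1)] by (simp add: nb_def)
    qed
    ultimately show ?thesis unfolding d_def using fin_nb by (auto intro: card_inj_on_le)
  qed
  then have d_eq: "d u = d z" if "(u, z) \<in> parcs G" for u z
    using that parcs_sym by (meson antisym)
  have walks: "(\<Sum>v<n. \<Sum>w<n. A $$ (u, v) * A $$ (v, w) * A $$ (w, z)) = (d u)\<^sup>2 * A $$ (u, z)"
    if uz: "u < n" "z < n" for u z
  proof -
    have "(\<Sum>v<n. \<Sum>w<n. A $$ (u, v) * A $$ (v, w) * A $$ (w, z))
        = (\<Sum>v<n. \<Sum>w<n. if v \<in> nb u \<and> w \<in> nb z then A $$ (u, z) else 0)"
    proof (intro sum.cong refl)
      fix v w assume "v \<in> {..<n}" "w \<in> {..<n}"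
      then have vw: "v < n" "w < n" by auto
      show "A $$ (u, v) * A $$ (v, w) * A $$ (w, z) = (if v \<in> nb u \<and> w \<in> nb z then A $$ (u, z) else 0)"
      proof (cases "(u, v) \<in> parcs G \<and> (v, w) \<in> parcs G \<and> (w, z) \<in> parcs G")
        case True
        then have "(u, v) \<in> parcs G" "(v, w) \<in> parcs G" "(w, z) \<in> parcs G" by auto
        then show ?thesis using walk[of u v w z] parcs_sym[of w z] uz vw by (simp add: A_index nb_def)
      next
        case False
        have "\<not> (v \<in> nb u \<and> w \<in> nb z \<and> (u, z) \<in> parcs G)"
        proof
          assume "v \<in> nb u \<and> w \<in> nb z \<and> (u, z) \<in> parcs G"
          then have *: "(u, v) \<in> parcs G" "(z, w) \<in> parcs G" "(u, z) \<in> parcs G" by (auto simp: nb_def)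
          then show False using walk(1)[OF parcs_sym[OF *(1)] *(3,2)] parcs_sym[OF *(2)] False by blast
        qed
        then show ?thesis using False uz vw by (auto simp: A_index)
      qed
    qed
    also have "\<dots> = (\<Sum>v\<in>nb u. \<Sum>w\<in>nb z. A $$ (u, z))"
    proof -
      have "(\<Sum>w<n. if v \<in> nb u \<and> w \<in> nb z then A $$ (u, z) else 0)
          = (if v \<in> nb u then \<Sum>w\<in>nb z. A $$ (u, z) else 0)" for v
        using nb_lt[of z] by (auto simp: sum.If_cases Int_absorb1)
      then show ?thesis using nb_lt[of u] by (simp add: sum.If_cases Int_absorb1)
    qed
    also have "\<dots> = d u * d z * A $$ (u, z)" by (simp add: d_def)
    also have "\<dots> = (d u)\<^sup>2 * A $$ (u, z)"
      using d_eq[of u z] uz by (auto simp: A_index power2_eq_square)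
    finally show ?thesis .
  qed
  have l_d: "\<bar>l i\<bar> = d u \<or> l i = 0 \<or> x i u = 0" if iu: "i < n" "u < n" for i u
  proof -
    have "l i * (l i * (l i * x i u)) = (\<Sum>v<n. A $$ (u, v) * (\<Sum>w<n. A $$ (v, w) * (\<Sum>z<n. A $$ (w, z) * x i z)))"
      using iu eig[of i] by (simp add: mult.left_commute[of "A $$ _" "complex_of_real _"] flip: sum_distrib_left)
    also have "\<dots> = (\<Sum>v<n. \<Sum>w<n. \<Sum>z<n. A $$ (u, v) * A $$ (v, w) * A $$ (w, z) * x i z)"
      by (simp add: sum_distrib_left mult.assoc)
    also have "\<dots> = (\<Sum>v<n. \<Sum>z<n. \<Sum>w<n. A $$ (u, v) * A $$ (v, w) * A $$ (w, z) * x i z)"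
      by (intro sum.cong refl sum.swap)
    also have "\<dots> = (\<Sum>z<n. \<Sum>v<n. \<Sum>w<n. A $$ (u, v) * A $$ (v, w) * A $$ (w, z) * x i z)"
      by (rule sum.swap)
    also have "\<dots> = (\<Sum>z<n. (d u)\<^sup>2 * A $$ (u, z) * x i z)"
      using walks[OF iu(2)] by (simp flip: sum_distrib_right)
    also have "\<dots> = (d u)\<^sup>2 * (l i * x i u)"
      using eig[OF iu] by (simp add: mult.assoc flip: sum_distrib_left)
    finally have eq: "l i * (l i * (l i * x i u)) = (d u)\<^sup>2 * (l i * x i u)" .
    show ?thesis
    proof (cases "l i = 0 \<or> x i u = 0")
      case False
      then have "complex_of_real ((l i)\<^sup>2) = complex_of_real ((d u)\<^sup>2)"
        using eq by (simp add: power2_eq_square)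
      then have "(l i)\<^sup>2 = (d u)\<^sup>2" by (simp only: of_real_eq_iff)
      then have "sqrt ((l i)\<^sup>2) = sqrt ((d u)\<^sup>2)" by (rule arg_cong)
      then show ?thesis by (simp add: d_def)
    qed auto
  qed
  have deg: "d u = (\<Sum>i<n. (l i)\<^sup>2 * (cmod (x i u))\<^sup>2)" if u: "u < n" for u
  proof -
    have "complex_of_real (d u) = (\<Sum>v\<in>nb u. 1)" by (simp add: d_def)
    also have "\<dots> = (\<Sum>v<n. if v \<in> nb u then 1 else 0)"
      using nb_lt[of u] by (simp add: sum.If_cases Int_absorb1)
    also have "\<dots> = (\<Sum>v<n. A $$ (u, v) * cnj (A $$ (u, v)))"
      using u gain_mult_cnj by (intro sum.cong) (auto simp: A_index nb_def)
    also have "\<dots> = (\<Sum>v<n. \<Sum>i<n. l i * x i u * cnj (A $$ (u, v) * x i v))"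
      using u by (intro sum.cong refl, subst S) (auto simp: sum_distrib_left mult_ac)
    also have "\<dots> = (\<Sum>i<n. l i * x i u * cnj (\<Sum>v<n. A $$ (u, v) * x i v))"
      by (subst sum.swap) (simp add: sum_distrib_left)
    also have "\<dots> = (\<Sum>i<n. l i * x i u * cnj (l i * x i u))"
      using eig u by (intro sum.cong) auto
    also have "\<dots> = complex_of_real (\<Sum>i<n. (l i)\<^sup>2 * (cmod (x i u))\<^sup>2)"
      unfolding of_real_sum of_real_mult complex_norm_square
      by (intro sum.cong refl) (simp add: power2_eq_square mult_ac)
    finally show ?thesis by (simp only: of_real_eq_iff)
  qed
  have vert: "(\<Sum>i<n. \<bar>l i\<bar> * (cmod (x i u))\<^sup>2) = (if u \<in> Domain (parcs G) then 1 else 0)" if u: "u < n" for u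
  proof (cases "nb u = {}")
    case True
    then have "(\<Sum>i<n. (l i)\<^sup>2 * (cmod (x i u))\<^sup>2) = 0" using deg[OF u] by (simp add: d_def)
    then have "l i = 0 \<or> x i u = 0" if "i < n" for i
      using that by (subst (asm) sum_nonneg_eq_0_iff) auto
    then have "(\<Sum>i<n. \<bar>l i\<bar> * (cmod (x i u))\<^sup>2) = 0" by (intro sum.neutral) auto
    then show ?thesis using True by (auto simp: nb_def)
  next
    case False
    then have d0: "d u \<noteq> 0" using fin_nb by (simp add: d_def)
    have "d u = (\<Sum>i<n. d u * (\<bar>l i\<bar> * (cmod (x i u))\<^sup>2))"
    proof -
      have "(l i)\<^sup>2 * (cmod (x i u))\<^sup>2 = d u * (\<bar>l i\<bar> * (cmod (x i u))\<^sup>2)" if i: "i < n" for i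
      proof -
        have "(l i)\<^sup>2 = \<bar>l i\<bar> * \<bar>l i\<bar>" by (simp add: power2_eq_square)
        then have sq: "(l i)\<^sup>2 * (cmod (x i u))\<^sup>2 = \<bar>l i\<bar> * (\<bar>l i\<bar> * (cmod (x i u))\<^sup>2)"
          by (simp only: mult.assoc)
        consider "\<bar>l i\<bar> = d u" | "l i = 0 \<or> x i u = 0" using l_d[OF i u] by blast
        then show ?thesis by cases (simp_all only: sq, auto)
      qed
      then have "(\<Sum>i<n. (l i)\<^sup>2 * (cmod (x i u))\<^sup>2) = (\<Sum>i<n. d u * (\<bar>l i\<bar> * (cmod (x i u))\<^sup>2))"
        by (intro sum.cong) auto
      then show ?thesis by (simp only: deg[OF u, symmetric])
    qed
    then have "d u * (\<Sum>i<n. \<bar>l i\<bar> * (cmod (x i u))\<^sup>2) = d u * 1" by (simp flip: sum_distrib_left)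
    then show ?thesis using d0 False by (auto simp: nb_def)
  qed
  have "(\<Sum>i<n. \<bar>l i\<bar>) = (\<Sum>i<n. \<Sum>u<n. \<bar>l i\<bar> * (cmod (x i u))\<^sup>2)"
    using N by (simp flip: sum_distrib_left)
  also have "\<dots> = (\<Sum>u<n. if u \<in> Domain (parcs G) then 1 else 0)"
    using vert by (subst sum.swap) simp
  also have "\<dots> = card (Domain (parcs G))"
  proof -
    have "Domain (parcs G) \<subseteq> {..<n}" using parcs_lt by blast
    then show ?thesis by (simp add: sum.If_cases Int_absorb1)
  qed
  finally show ?thesis using E by simp
qed

end

lemma (in pair_fin_digraph) finite_vertex_covers: "finite {C. vertex_cover (with_proj G) C}"
  by (rule finite_subset[of _ "Pow (pverts G)"]) (auto simp: vertex_cover_def pair_finite_verts)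

lemma (in pair_fin_digraph) vertex_cover_number_le:
  "vertex_cover (with_proj G) C \<Longrightarrow> vertex_cover_number (with_proj G) \<le> card C"
  unfolding vertex_cover_number_def using finite_vertex_covers by (intro Min_le) auto

lemma (in pair_fin_digraph) vertex_cover_number_attained:
  obtains C where "vertex_cover (with_proj G) C" "card C = vertex_cover_number (with_proj G)"
proof -
  have "vertex_cover (with_proj G) (pverts G)"
    using arc_fst_in_verts by (auto simp: vertex_cover_def)
  then have "vertex_cover_number (with_proj G) \<in> card ` {C. vertex_cover (with_proj G) C}"
    unfolding vertex_cover_number_def using finite_vertex_covers by (intro Min_in) auto
  then show ?thesis using that by auto
qed

lemma disjoint_doubletons_involution:
  assumes M: "pairwise disjnt M" and E: "\<And>e. e \<in> M \<Longrightarrow> \<exists>u v. e = {u, v} \<and> u \<noteq> v"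
  obtains m where "\<And>v. v \<in> \<Union>M \<Longrightarrow> {v, m v} \<in> M \<and> m (m v) = v"
proof -
  define m where "m v = (SOME w. {v, w} \<in> M)" for v
  have uniq: "w = w'" if "{v, w} \<in> M" "{v, w'} \<in> M" for v w w'
  proof -
    have "{v, w} = {v, w'}"
      by (rule ccontr) (use pairwiseD[OF M that] in \<open>auto simp: disjnt_def\<close>)
    then show ?thesis by (auto simp: doubleton_eq_iff)
  qed
  have m: "{v, m v} \<in> M" if "v \<in> \<Union>M" for v
  proof -
    from that obtain e where e: "e \<in> M" "v \<in> e" by blast
    with E[OF e(1)] obtain w where "e = {v, w}" by auto
    with e show ?thesis unfolding m_def by (metis someI)
  qed
  have "m (m v) = v" if v: "v \<in> \<Union>M" for v
  proof (rule uniq)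
    show "{m v, m (m v)} \<in> M" using m[OF v] by (intro m) auto
    show "{m v, v} \<in> M" using m[OF v] by (simp add: insert_commute)
  qed
  with m show ?thesis using that by blast
qed

context T_gain_graph
begin

lemma not_loop: "(u, u) \<notin> parcs G"
  using no_loops' by blast

lemma large_matching:
  obtains D m where "matching_involution G D m"
    "2 * vertex_cover_number (with_proj G) \<le> card D + 2 * odd_cycle_number (with_proj G)"
proof -
  let ?\<tau> = "vertex_cover_number (with_proj G)"
  obtain S where S: "S \<subseteq> pverts G" "card S \<le> odd_cycle_number (with_proj G)"
    "\<And>c. oriented_cycle (with_proj G) c \<Longrightarrow> odd (length c) \<Longrightarrow> \<exists>a\<in>set c. fst a \<in> S \<or> snd a \<in> S"
    using odd_cycle_transversal by blast
  define R where "R = {(u, v). (u, v) \<in> parcs G \<and> u \<notin> S \<and> v \<notin> S}"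
  have R: "R \<subseteq> parcs G" by (auto simp: R_def)
  have symR: "sym R" using parcs_sym by (auto simp: R_def sym_def)
  have "\<forall>u k. (u, u) \<in> R ^^ k \<longrightarrow> even k"
  proof (intro allI impI, rule ccontr)
    fix u k assume k: "(u, u) \<in> R ^^ k" and "odd k"
    then obtain k' where "k = Suc k'" by (cases k) auto
    then obtain y where "(y, u) \<in> R" using k by auto
    then have "u \<in> pverts G" using R in_arcsD2 by blast
    then obtain p where p: "awalk u p u" "length p = k" "set p \<subseteq> R" using relpow_imp_awalk[OF k R] by blast
    then obtain c where "oriented_cycle (with_proj G) c" "odd (length c)" "set c \<subseteq> set p"
      using odd_closed_awalk_imp_odd_cycle[of u p] \<open>odd k\<close> by auto
    then show False using S(3)[of c] p(3) by (auto simp: R_def)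
  qed
  from two_colouring_if_no_odd_closed_walk[OF symR this]
  obtain col :: "nat \<Rightarrow> bool" where col: "\<And>u v. (u, v) \<in> R \<Longrightarrow> col u \<noteq> col v" by blast
  define E where "E = (\<lambda>(u, v). {u, v}) ` R"
  have finS: "finite S" using S(1) pair_finite_verts by (rule finite_subset)
  have finE: "finite E" unfolding E_def by (intro finite_imageI finite_subset[OF R pair_finite_arcs])
  have colE: "\<forall>e\<in>E. \<exists>u v. e = {u, v} \<and> col u \<noteq> col v"
    using col by (fastforce simp: E_def)
  have covE: "\<forall>C. finite C \<longrightarrow> (\<forall>e\<in>E. e \<inter> C \<noteq> {}) \<longrightarrow> ?\<tau> - card S \<le> card C"
  proof (intro allI impI)
    fix C assume C: "finite C" "\<forall>e\<in>E. e \<inter> C \<noteq> {}"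
    have "vertex_cover (with_proj G) ((C \<inter> pverts G) \<union> S)"
      unfolding vertex_cover_def
    proof (intro conjI ballI)
      fix a assume a: "a \<in> arcs (with_proj G)"
      obtain u v where uv: "a = (u, v)" by (cases a)
      show "tail (with_proj G) a \<in> C \<inter> pverts G \<union> S \<or> head (with_proj G) a \<in> C \<inter> pverts G \<union> S"
      proof (cases "u \<in> S \<or> v \<in> S")
        case False
        then have "{u, v} \<in> E" using a uv by (auto simp: E_def R_def)
        then have "u \<in> C \<or> v \<in> C" using C(2) by auto
        then show ?thesis using a uv in_arcsD1 in_arcsD2 by auto
      qed (use uv in auto)
    qed (use S in auto)
    then have "?\<tau> \<le> card ((C \<inter> pverts G) \<union> S)" by (rule vertex_cover_number_le)
    also have "\<dots> \<le> card (C \<inter> pverts G) + card S" by (rule card_Un_le)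
    also have "card (C \<inter> pverts G) \<le> card C" using C(1) by (intro card_mono) auto
    finally show "?\<tau> - card S \<le> card C" by simp
  qed
  obtain M where M: "M \<subseteq> E" "pairwise disjnt M" "?\<tau> - card S \<le> card M"
    using koenig[OF finE colE covE] by blast
  have ME: "\<exists>u v. e = {u, v} \<and> u \<noteq> v \<and> (u, v) \<in> parcs G" if "e \<in> M" for e
  proof -
    have "e \<in> E" using that M(1) by blast
    then obtain u v where "e = {u, v}" "(u, v) \<in> R" unfolding E_def by auto
    then show ?thesis using R not_loop by (metis subsetD)
  qed
  obtain m where m: "\<And>v. v \<in> \<Union>M \<Longrightarrow> {v, m v} \<in> M \<and> m (m v) = v"
    by (rule disjoint_doubletons_involution[OF M(2)]) (use ME in blast)+
  have "matching_involution G (\<Union>M) m"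
    unfolding matching_involution_def
  proof (intro ballI conjI)
    fix v assume v: "v \<in> \<Union>M"
    show "m v \<in> \<Union>M" "m (m v) = v" using m[OF v] by auto
    show "(v, m v) \<in> parcs G" using ME[of "{v, m v}"] m[OF v] parcs_sym by (auto simp: doubleton_eq_iff)
  qed
  moreover have "card (\<Union>M) = 2 * card M"
  proof -
    have "card (\<Union>M) = sum card M"
      using M(2) ME by (intro card_Union_disjoint) fastforce+
    also have "\<dots> = sum (\<lambda>_. 2) M" using ME by (intro sum.cong) fastforce+
    finally show ?thesis by simp
  qed
  ultimately show ?thesis using that[of "\<Union>M" m] M(3) S(2) by simp
qed

lemma odd_awalk_arc:
  assumes closed: "three_walk_closed G \<phi>"
  shows "awalk u p v \<Longrightarrow> odd (length p) \<Longrightarrow> (u, v) \<in> parcs G \<and> \<phi> (u, v) = (\<Prod>a\<leftarrow>p. \<phi> a)"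
proof (induction p arbitrary: u rule: induct_list012)
  case (2 a)
  then show ?case by (cases a) (auto simp: awalk_simps)
next
  case (3 a b q)
  obtain w x where ab: "a = (u, w)" "b = (w, x)" "(u, w) \<in> parcs G" "(w, x) \<in> parcs G" "awalk x q v"
    using "3.prems"(1) by (cases a; cases b) (auto simp: awalk_simps)
  then have "(x, v) \<in> parcs G" "\<phi> (x, v) = (\<Prod>a\<leftarrow>q. \<phi> a)" using "3.IH"(1)[of x] "3.prems"(2) by auto
  with closed ab have "(u, v) \<in> parcs G" "\<phi> (u, v) = \<phi> (u, w) * \<phi> (w, x) * (\<Prod>a\<leftarrow>q. \<phi> a)"
    unfolding three_walk_closed_def by metis+
  then show ?case by (simp add: ab(1,2) mult.assoc)
qed simp

lemma three_walk_closed_no_odd_cycle: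
  assumes "three_walk_closed G \<phi>"
  shows "odd_cycle_number (with_proj G) = 0"
proof -
  have "\<not> (oriented_cycle (with_proj G) c \<and> odd (length c))" for c
    using odd_awalk_arc[OF assms] not_loop by (auto simp: oriented_cycle_def cycle_def)
  then have "{undirected_edges (with_proj G) (set c) | c. oriented_cycle (with_proj G) c \<and> odd (length c)} = {}"
    by blast
  then show ?thesis unfolding odd_cycle_number_def by (simp only: card.empty)
qed

lemma card_Domain_le:
  assumes m: "matching_involution G (Domain (parcs G)) m"
  shows "card (Domain (parcs G)) \<le> 2 * vertex_cover_number (with_proj G)"
proof -
  obtain C where C: "vertex_cover (with_proj G) C" "card C = vertex_cover_number (with_proj G)"
    by (rule vertex_cover_number_attained)
  have finC: "finite C" using C(1) pair_finite_verts by (auto simp: vertex_cover_def intro: finite_subset)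
  have "Domain (parcs G) \<subseteq> C \<union> m ` C"
  proof
    fix v assume "v \<in> Domain (parcs G)"
    then have "m (m v) = v" "(v, m v) \<in> parcs G" using m by (auto simp: matching_involution_def)
    then show "v \<in> C \<union> m ` C" using C(1) by (force simp: vertex_cover_def intro: rev_image_eqI)
  qed
  then have "card (Domain (parcs G)) \<le> card (C \<union> m ` C)" using finC by (intro card_mono) auto
  also have "\<dots> \<le> card C + card (m ` C)" by (rule card_Un_le)
  also have "card (m ` C) \<le> card C" using finC by (rule card_image_le)
  finally show ?thesis using C(2) by simp
qed

lemma energy_ge:
  "gain_energy G n \<phi> \<ge> 2 * real (vertex_cover_number (with_proj G)) - 2 * real (odd_cycle_number (with_proj G))"
proof -
  obtain D m where D: "matching_involution G D m"
    "2 * vertex_cover_number (with_proj G) \<le> card D + 2 * odd_cycle_number (with_proj G)"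
    by (rule large_matching)
  show ?thesis using card_matching_le_energy[OF D(1)] D(2) by linarith
qed

lemma energy_eq_iff:
  "gain_energy G n \<phi> = 2 * real (vertex_cover_number (with_proj G)) - 2 * real (odd_cycle_number (with_proj G))
    \<longleftrightarrow> three_walk_closed G \<phi> \<and> (\<exists>m. matching_involution G (Domain (parcs G)) m)" (is "?eq \<longleftrightarrow> _")
proof
  assume ?eq
  obtain D m where D: "matching_involution G D m"
    "2 * vertex_cover_number (with_proj G) \<le> card D + 2 * odd_cycle_number (with_proj G)"
    by (rule large_matching)
  have "real (card D) = gain_energy G n \<phi>" using card_matching_le_energy[OF D(1)] D(2) \<open>?eq\<close> by linarith
  then show "three_walk_closed G \<phi> \<and> (\<exists>m. matching_involution G (Domain (parcs G)) m)"
    using card_matching_eq_energyD[OF D(1)] D(1) by blast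
next
  assume "three_walk_closed G \<phi> \<and> (\<exists>m. matching_involution G (Domain (parcs G)) m)"
  then obtain m where closed: "three_walk_closed G \<phi>" and m: "matching_involution G (Domain (parcs G)) m" by blast
  show ?eq
    using energy_ge three_walk_closed_energy[OF m closed] card_Domain_le[OF m] three_walk_closed_no_odd_cycle[OF closed]
    by simp
qed

section \<open>Connected components\<close>

definition component_of :: "nat \<Rightarrow> nat pair_pre_digraph" where
  "component_of u = \<lparr>pverts = {v. u \<rightarrow>\<^sup>*\<^bsub>with_proj G\<^esub> v},
     parcs = {(v, w). (v, w) \<in> parcs G \<and> u \<rightarrow>\<^sup>*\<^bsub>with_proj G\<^esub> v \<and> u \<rightarrow>\<^sup>*\<^bsub>with_proj G\<^esub> w}\<rparr>"

lemma component_of_simps: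
  "pverts (component_of u) = {v. u \<rightarrow>\<^sup>*\<^bsub>with_proj G\<^esub> v}"
  "(v, w) \<in> parcs (component_of u) \<longleftrightarrow>
     (v, w) \<in> parcs G \<and> u \<rightarrow>\<^sup>*\<^bsub>with_proj G\<^esub> v \<and> u \<rightarrow>\<^sup>*\<^bsub>with_proj G\<^esub> w"
  by (simp_all add: component_of_def)

lemma gain_components_conv: "gain_components G = (\<lambda>u. with_proj (component_of u)) ` pverts G"
proof -
  have "G \<restriction> {v. u \<rightarrow>\<^sup>*\<^bsub>with_proj G\<^esub> v} = with_proj (component_of u)" for u
    by (auto simp: induce_subgraph_def component_of_def with_proj_def)
  moreover have "scc_of u = {v. u \<rightarrow>\<^sup>*\<^bsub>with_proj G\<^esub> v}" for u
    using symmetric_reachable' by (auto simp: scc_of_def)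
  ultimately show ?thesis
    unfolding gain_components_def sccs_conv_sccs_verts sccs_verts_conv_scc_of image_image by simp
qed

lemma reachable_arc: "(u, v) \<in> parcs G \<Longrightarrow> u \<rightarrow>\<^sup>*\<^bsub>with_proj G\<^esub> v"
  using reachable_adjI by simp

lemma reachable_iff_awalk: "u \<rightarrow>\<^sup>*\<^bsub>with_proj G\<^esub> v \<longleftrightarrow> (\<exists>p. awalk u p v)"
  using reachable_awalk by simp

lemma component_of_cong: "(u, v) \<in> parcs G \<Longrightarrow> component_of u = component_of v"
proof -
  assume uv: "(u, v) \<in> parcs G"
  have "u \<rightarrow>\<^sup>*\<^bsub>with_proj G\<^esub> w \<longleftrightarrow> v \<rightarrow>\<^sup>*\<^bsub>with_proj G\<^esub> w" for w
    using reachable_trans reachable_arc[OF uv] reachable_arc[OF parcs_sym[OF uv]] by blast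
  then show ?thesis by (simp add: component_of_def)
qed

lemma reachable_iff_nbs:
  assumes closed: "three_walk_closed G \<phi>" and uw: "(u, w) \<in> parcs G"
  shows "u \<rightarrow>\<^sup>*\<^bsub>with_proj G\<^esub> v \<longleftrightarrow> (u, v) \<in> parcs G \<or> (w, v) \<in> parcs G"
proof
  assume "u \<rightarrow>\<^sup>*\<^bsub>with_proj G\<^esub> v"
  then obtain p where p: "awalk u p v" using reachable_iff_awalk by blast
  show "(u, v) \<in> parcs G \<or> (w, v) \<in> parcs G"
  proof (cases "odd (length p)")
    case True
    then show ?thesis using odd_awalk_arc[OF closed p] by blast
  next
    case False
    have "awalk w ((w, u) # p) v" using p parcs_sym[OF uw] by (simp add: awalk_Cons_iff)
    then show ?thesis using odd_awalk_arc[OF closed, of w "(w, u) # p" v] False by simp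
  qed
next
  assume "(u, v) \<in> parcs G \<or> (w, v) \<in> parcs G"
  then show "u \<rightarrow>\<^sup>*\<^bsub>with_proj G\<^esub> v" using reachable_arc uw reachable_trans by blast
qed

lemma cycle_component_of:
  assumes "oriented_cycle (with_proj (component_of u)) c"
  shows "oriented_cycle (with_proj G) c"
proof -
  have *: "u \<rightarrow>\<^sup>*\<^bsub>with_proj G\<^esub> v \<Longrightarrow> v \<in> pverts G" for v
    by (auto dest: reachable_in_verts)
  show ?thesis using assms *
    by (auto simp: oriented_cycle_def pre_digraph.cycle_def pre_digraph.awalk_def
        cas_with_proj_eq awalk_verts_with_proj_eq component_of_def)
qed

lemma balanced_component_of:
  assumes closed: "three_walk_closed G \<phi>"
  shows "balanced (with_proj (component_of u)) \<phi>"
  unfolding balanced_def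
proof (intro allI impI)
  fix c assume "oriented_cycle (with_proj (component_of u)) c"
  then have c: "oriented_cycle (with_proj G) c" by (rule cycle_component_of)
  then obtain x where x: "awalk x c x" "c \<noteq> []" by (auto simp: oriented_cycle_def cycle_def)
  then obtain y p where p: "c = (x, y) # p" "(x, y) \<in> parcs G" "awalk y p x"
    by (cases c) (auto simp: awalk_Cons_iff)
  have "even (length c)" using odd_awalk_arc[OF closed x(1)] not_loop by blast
  then have "\<phi> (y, x) = (\<Prod>a\<leftarrow>p. \<phi> a)" using odd_awalk_arc[OF closed p(3)] p(1) by simp
  then show "(\<Prod>a\<leftarrow>c. \<phi> a) = 1" using gain_mult_cnj[OF p(2)] gain_cnj[OF p(2)] p(1) by simp
qed

lemma three_walk_closed_imp_component:
  assumes closed: "three_walk_closed G \<phi>" and m: "matching_involution G (Domain (parcs G)) m"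
    and u: "u \<in> pverts G"
  defines "H \<equiv> with_proj (component_of u)"
  shows "isolated_vertex H \<or> balanced H \<phi> \<and> complete_bipartite H \<and> has_perfect_matching H"
proof (cases "u \<in> Domain (parcs G)")
  case False
  have only: "v = u" if uv: "u \<rightarrow>\<^sup>*\<^bsub>with_proj G\<^esub> v" for v
  proof -
    obtain p where "awalk u p v" using uv reachable_iff_awalk by blast
    then show ?thesis using False by (cases p) (auto simp: awalk_simps)
  qed
  have "pverts (component_of u) = {u}" using only u by (auto simp: component_of_simps)
  moreover have "(a, b) \<notin> parcs (component_of u)" for a b
    using only[of a] only[of b] not_loop[of u] by (auto simp: component_of_simps)
  then have "parcs (component_of u) = {}" by auto
  ultimately show ?thesis by (simp add: H_def isolated_vertex_def)
next
  case True
  have m_arc: "(v, m v) \<in> parcs G" "m (m v) = v" if "(v, w) \<in> parcs G" for v w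
    using m that by (auto simp: matching_involution_def)
  have closed3: "(a, d) \<in> parcs G" if "(a, b) \<in> parcs G" "(b, c) \<in> parcs G" "(c, d) \<in> parcs G" for a b c d
    using closed that unfolding three_walk_closed_def by blast
  define w where "w = m u"
  have uw: "(u, w) \<in> parcs G" using True m_arc(1) by (auto simp: w_def)
  note reach = reachable_iff_nbs[OF closed uw]
  define U V where "U = {v. (w, v) \<in> parcs G}" and "V = {v. (u, v) \<in> parcs G}"
  have "U \<subseteq> {..<n}" "V \<subseteq> {..<n}" using parcs_lt by (auto simp: U_def V_def)
  then have fin: "finite U" "finite V" by (auto intro: finite_subset)
  have verts: "pverts (component_of u) = U \<union> V"
    by (auto simp: component_of_simps reach U_def V_def)
  have disj: "U \<inter> V = {}"
  proof -
    have False if "(w, v) \<in> parcs G" "(u, v) \<in> parcs G" for v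
      using closed3[OF parcs_sym[OF that(2)] uw that(1)] not_loop by blast
    then show ?thesis by (auto simp: U_def V_def)
  qed
  have arcs: "parcs (component_of u) = U \<times> V \<union> V \<times> U"
  proof (rule subset_antisym; rule subsetI)
    fix e assume "e \<in> parcs (component_of u)"
    then obtain a b where ab: "e = (a, b)" "(a, b) \<in> parcs G" "a \<in> U \<union> V" "b \<in> U \<union> V"
      by (cases e) (auto simp: component_of_simps reach U_def V_def)
    have "\<not> (a \<in> U \<and> b \<in> U)" "\<not> (a \<in> V \<and> b \<in> V)"
      using closed3[OF _ ab(2), of w w] closed3[OF _ ab(2), of u u] parcs_sym not_loop
      by (auto simp: U_def V_def)
    then show "e \<in> U \<times> V \<union> V \<times> U" using ab by auto
  next
    fix e assume "e \<in> U \<times> V \<union> V \<times> U"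
    then obtain a b where ab: "e = (a, b)" "a \<in> U \<and> b \<in> V \<or> a \<in> V \<and> b \<in> U" by auto
    then have "(a, b) \<in> parcs G"
      using closed3[of a w u b] closed3[of a u w b] parcs_sym uw by (auto simp: U_def V_def)
    then show "e \<in> parcs (component_of u)" using ab by (auto simp: component_of_simps reach U_def V_def)
  qed
  have "K\<^bsub>card U,card V\<^esub> H"
    unfolding H_def complete_bipartite_digraph_pair_def using verts disj arcs fin by auto
  then have "complete_bipartite H" by (auto simp: complete_bipartite_def)
  moreover have "has_perfect_matching H"
    unfolding has_perfect_matching_def
  proof (intro exI conjI ballI)
    let ?M = "(\<lambda>v. {v, m v}) ` pverts (component_of u)"
    have mem: "\<exists>w. (v, w) \<in> parcs G" if "v \<in> pverts (component_of u)" for v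
      using that parcs_sym by (auto simp: verts U_def V_def)
    show "?M \<subseteq> undirected_edges H (arcs H)"
    proof
      fix e assume "e \<in> ?M"
      then obtain v where v: "v \<in> pverts (component_of u)" "e = {v, m v}" by blast
      then have vm: "(v, m v) \<in> parcs G" using mem m_arc(1) by blast
      then have "(v, m v) \<in> parcs (component_of u)"
        using v(1) reachable_trans[OF _ reachable_arc[OF vm]] by (auto simp: component_of_simps)
      then show "e \<in> undirected_edges H (arcs H)"
        using v(2) by (force simp: undirected_edges_def H_def)
    qed
    fix v assume "v \<in> verts H"
    then have v: "v \<in> pverts (component_of u)" by (simp add: H_def)
    show "\<exists>!e. e \<in> ?M \<and> v \<in> e"
    proof (rule ex1I[of _ "{v, m v}"])
      show "{v, m v} \<in> ?M \<and> v \<in> {v, m v}" using v by blast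
      fix e assume "e \<in> ?M \<and> v \<in> e"
      then obtain x where x: "x \<in> pverts (component_of u)" "e = {x, m x}" "v = x \<or> v = m x" by auto
      then show "e = {v, m v}" using m_arc(2) mem[OF x(1)] by auto
    qed
  qed
  ultimately show ?thesis using balanced_component_of[OF closed] by (simp add: H_def)
qed

lemma component_three_walk:
  assumes bal: "balanced (with_proj (component_of u)) \<phi>"
    and bip: "complete_bipartite (with_proj (component_of u))"
    and arcs: "(u, v) \<in> parcs G" "(v, w) \<in> parcs G" "(w, z) \<in> parcs G"
  shows "(u, z) \<in> parcs G \<and> \<phi> (u, z) = \<phi> (u, v) * \<phi> (v, w) * \<phi> (w, z)"
proof -
  let ?H = "component_of u"
  have "u \<rightarrow>\<^sup>*\<^bsub>with_proj G\<^esub> u" "u \<rightarrow>\<^sup>*\<^bsub>with_proj G\<^esub> v" "u \<rightarrow>\<^sup>*\<^bsub>with_proj G\<^esub> w" "u \<rightarrow>\<^sup>*\<^bsub>with_proj G\<^esub> z"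
    using in_arcsD1[OF arcs(1)] arcs[THEN reachable_arc] by (auto intro: reachable_trans)
  then have H: "(u, v) \<in> parcs ?H" "(v, w) \<in> parcs ?H" "(w, z) \<in> parcs ?H"
    using arcs by (simp_all add: component_of_simps)
  obtain U V where UV: "U \<inter> V = {}" "parcs ?H = U \<times> V \<union> V \<times> U"
    using bip unfolding complete_bipartite_def complete_bipartite_digraph_pair_def by blast
  have uz: "(u, z) \<in> parcs ?H" "(z, u) \<in> parcs ?H" and ne: "u \<noteq> v" "v \<noteq> w" "w \<noteq> z" "z \<noteq> u"
    using H UV by auto
  then have uzG: "(u, z) \<in> parcs G" by (simp add: component_of_simps)
  have "\<phi> (u, z) = \<phi> (u, v) * \<phi> (v, w) * \<phi> (w, z)"
  proof (cases "u = w \<or> v = z")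
    case True
    then show ?thesis
    proof
      assume "u = w"
      then show ?thesis using gain_mult_cnj[OF arcs(1)] gain_cnj[OF arcs(1)] by simp
    next
      assume "v = z"
      then show ?thesis using gain_mult_cnj[OF arcs(2)] gain_cnj[OF arcs(2)] by (simp add: mult.assoc)
    qed
  next
    case False
    have "u \<in> pverts ?H" using H(1) by (simp add: component_of_simps)
    then have "oriented_cycle (with_proj ?H) [(u, v), (v, w), (w, z), (z, u)]"
      using H uz ne False
      by (auto simp: oriented_cycle_def pre_digraph.cycle_def pre_digraph.awalk_def
          cas_with_proj_eq awalk_verts_with_proj_eq intro!: exI[of _ u])
    then have "\<phi> (u, v) * \<phi> (v, w) * \<phi> (w, z) * cnj (\<phi> (u, z)) = 1"
      using bal gain_cnj[OF uzG] unfolding balanced_def by (fastforce simp: mult.assoc)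
    then have "\<phi> (u, v) * \<phi> (v, w) * \<phi> (w, z) * (\<phi> (u, z) * cnj (\<phi> (u, z))) = \<phi> (u, z)"
      by (simp add: mult_ac)
    then show ?thesis using gain_mult_cnj[OF uzG] by simp
  qed
  then show ?thesis using uzG by simp
qed

lemma components_iff:
  "three_walk_closed G \<phi> \<and> (\<exists>m. matching_involution G (Domain (parcs G)) m) \<longleftrightarrow>
     (\<forall>H \<in> gain_components G. isolated_vertex H \<or> balanced H \<phi> \<and> complete_bipartite H \<and> has_perfect_matching H)"
proof
  assume "three_walk_closed G \<phi> \<and> (\<exists>m. matching_involution G (Domain (parcs G)) m)"
  then show "\<forall>H \<in> gain_components G. isolated_vertex H \<or> balanced H \<phi> \<and> complete_bipartite H \<and> has_perfect_matching H"
    unfolding gain_components_conv using three_walk_closed_imp_component by blast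
next
  assume comp: "\<forall>H \<in> gain_components G. isolated_vertex H \<or> balanced H \<phi> \<and> complete_bipartite H \<and> has_perfect_matching H"
  let ?H = "\<lambda>u. with_proj (component_of u)"
  have good: "balanced (?H u) \<phi>" "complete_bipartite (?H u)" "has_perfect_matching (?H u)"
    if uv: "(u, v) \<in> parcs G" for u v
  proof -
    have "?H u \<in> gain_components G" using in_arcsD1[OF uv] by (simp add: gain_components_conv)
    moreover have "(u, v) \<in> parcs (component_of u)"
      using uv reachable_arc[OF uv] in_arcsD1[OF uv] by (simp add: component_of_simps)
    ultimately show "balanced (?H u) \<phi>" "complete_bipartite (?H u)" "has_perfect_matching (?H u)"
      using comp by (auto simp: isolated_vertex_def)
  qed
  have "three_walk_closed G \<phi>"
    unfolding three_walk_closed_def using component_three_walk good by blast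
  moreover have "\<exists>m. matching_involution G (Domain (parcs G)) m"
  proof -
    define MM where "MM C = (SOME M. M \<subseteq> undirected_edges (with_proj C) (parcs C) \<and>
      (\<forall>v \<in> pverts C. \<exists>!e. e \<in> M \<and> v \<in> e))" for C :: "nat pair_pre_digraph"
    have MM: "MM (component_of u) \<subseteq> undirected_edges (?H u) (parcs (component_of u))"
      "\<forall>x \<in> pverts (component_of u). \<exists>!e. e \<in> MM (component_of u) \<and> x \<in> e"
      if uv: "(u, v) \<in> parcs G" for u v
      using someI_ex[OF good(3)[OF uv, unfolded has_perfect_matching_def with_proj_simps]] unfolding MM_def by blast+
    define m where "m v = (SOME w. {v, w} \<in> MM (component_of v))" for v
    have m: "{v, m v} \<in> MM (component_of v)" "(v, m v) \<in> parcs G" if vx: "(v, x) \<in> parcs G" for v x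
    proof -
      have "v \<in> pverts (component_of v)" using in_arcsD1[OF vx] by (simp add: component_of_simps)
      then obtain e where e: "e \<in> MM (component_of v)" "v \<in> e" using MM(2)[OF vx] by blast
      then obtain a b where "e = {a, b}" using MM(1)[OF vx] by (auto simp: undirected_edges_def)
      then obtain w where "e = {v, w}" using e(2) by auto
      then show *: "{v, m v} \<in> MM (component_of v)" using e(1) unfolding m_def by (metis someI)
      then obtain a b where "{v, m v} = {a, b}" "(a, b) \<in> parcs (component_of v)"
        using MM(1)[OF vx] by (auto simp: undirected_edges_def)
      then show "(v, m v) \<in> parcs G"
        using parcs_sym by (auto simp: component_of_simps doubleton_eq_iff)
    qed
    have "m (m v) = v" if vx: "(v, x) \<in> parcs G" for v x
    proof -
      note vm = m(2)[OF vx]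
      have eq: "component_of (m v) = component_of v" using component_of_cong[OF vm] by simp
      have "{m v, m (m v)} \<in> MM (component_of v)" "{m v, v} \<in> MM (component_of v)"
        using m(1)[OF parcs_sym[OF vm]] m(1)[OF vx] eq by (simp_all add: insert_commute)
      moreover have "m v \<in> pverts (component_of v)" using reachable_arc[OF vm] by (simp add: component_of_simps)
      ultimately have "{m v, m (m v)} = {m v, v}" using MM(2)[OF vx] by blast
      then show ?thesis by (auto simp: doubleton_eq_iff)
    qed
    then show ?thesis using m(2) parcs_sym unfolding matching_involution_def by blast
  qed
  ultimately show "three_walk_closed G \<phi> \<and> (\<exists>m. matching_involution G (Domain (parcs G)) m)" by blast
qed

end

theorem theorem4p20:
  fixes G :: "nat pair_pre_digraph" and n :: nat and \<phi> :: "nat \<times> nat \<Rightarrow> complex"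
  assumes "T_gain_graph G n \<phi>"
  shows "gain_energy G n \<phi>
           \<ge> 2 * real (vertex_cover_number (with_proj G)) - 2 * real (odd_cycle_number (with_proj G))
       \<and> (gain_energy G n \<phi>
           = 2 * real (vertex_cover_number (with_proj G)) - 2 * real (odd_cycle_number (with_proj G))
         \<longleftrightarrow> (\<forall>H \<in> gain_components G.
               isolated_vertex H \<or>
               balanced H \<phi> \<and> complete_bipartite H \<and> has_perfect_matching H))"
proof -
  interpret T_gain_graph G n \<phi> by (rule assms)
  show ?thesis using energy_ge energy_eq_iff components_iff by blast
qed

end
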